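(* Let $\mathbf P$ be a finite poset, $M\in\operatorname{mod}\Bbbk[\mathbf P]$, and $I$ an interval of $\mathbf P$. Fix arbitrary total orders on $\mathrm{sc}(I)$ and $\mathrm{sk}(I)$, arbitrary choice maps $\mathbf c\colon \mathrm{sc}({\Uparrow}I)\to\mathrm{sc}(I)$ and $\mathbf d\colon\mathrm{sk}({\Downarrow}I)\to\mathrm{sk}(I)$, and an arbitrary pair $(b_*,a_* )\in\mathrm{sk}(I)\times\mathrm{sc}(I)$ with $b_*\ge a_*$. Then $$d_M(V_I)=\operatorname{rank}\begin{bmatrix}\mathsf M_1&\mathbf 0&\mathbf 0\\ \mathsf M_2&\mathbf 0&\mathbf 0\\ \mathsf M_3&\mathsf M_4&\mathsf M_5\end{bmatrix}-\operatorname{rank}\begin{bmatrix}\mathsf M_1&\mathbf 0&\mathbf 0\\ \mathsf M_2&\mathbf 0&\mathbf 0\\ \mathbf 0&\mathsf M_4&\mathsf M_5\end{bmatrix},$$ where the block rows are indexed by $\mathrm{sc}_1(I)$, $\mathrm{sc}({\Uparrow}I)$, $\mathrm{sk}(I)$ and the block columns by $\mathrm{sc}(I)$, $\mathrm{sk}({\Downarrow}I)$, $\mathrm{sk}_1(I)$ (in these orders), and the blocks are the following matrices of linear maps: $$(\mathsf M_1)_{\mathbf a_c,a}=\begin{cases}M_{c,a}&(a=\underline{\mathbf a})\\-M_{c,a}&(a=\overline{\mathbf a})\\ \mathbf 0&(a\notin\mathbf a)\end{cases},\qquad (\mathsf M_5)_{b,\mathbf b_d}=\begin{cases}M_{b,d}&(b=\underline{\mathbf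 b})\\-M_{b,d}&(b=\overline{\mathbf b})\\ \mathbf 0&(b\notin\mathbf b)\end{cases},$$ $$\mathsf M_2=\big[\delta_{a,\mathbf c(a')}M_{a',\mathbf c(a')}\big]_{(a',a)\in\mathrm{sc}({\Uparrow}I)\times\mathrm{sc}(I)},\qquad \mathsf M_4=\big[\delta_{b,\mathbf d(b')}M_{\mathbf d(b'),b'}\big]_{(b,b')\in\mathrm{sk}(I)\times\mathrm{sk}({\Downarrow}I)},$$ and $\mathsf M_3$ (indexed by $\mathrm{sk}(I)\times\mathrm{sc}(I)$) has $(b_*,a_* )$-entry $M_{b_*,a_*}$ and all other entries zero. Index sets may be empty, in which case the corresponding block rows or columns are removed.
   Context: $\Bbbk$ is a field. The finite poset $\mathbf P$ is regarded as a category with exactly one morphism $p_{y,x}\colon x\to y$ when $x\le y$ and none otherwise; $\Bbbk[\mathbf P]$ is its $\Bbbk$-linearization, and $\operatorname{mod}\Bbbk[\mathbf P]$ is the category of $\Bbbk$-linear functors from $\Bbbk[\mathbf P]$ to finite-dimensional $\Bbbk$-vector spaces (equivalently functors $M\colon\mathbf P\to\operatorname{mod}\Bbbk$). For $x\le y$ write $M_{y,x}:=M(p_{y,x})\colon M(x)\to M(y)$. An interval of $\mathbf P$ is a nonempty full subposet $I$ that is connected (any two elements are joined by a sequence of consecutively comparable elements of $I$) and convex ($x\le z\le y$ with $x,y\in I$ implies $z\in I$). The interval module $V_I$ has $V_I(x)=\Bbbk$ for $x\in I$, $V_I(x)=0$ otherwise, and $V_I(p_{y,x})=\mathrm{id}_\Bbbk$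 for $x\le y$ in $I$, all other structure maps $0$. It is indecomposable, and $d_M(V_I)$ denotes its multiplicity in a decomposition of $M$ into indecomposables (Krull–Schmidt). For a subset $U\subseteq\mathbf P$: $\mathrm{sc}(U)$ and $\mathrm{sk}(U)$ are the sets of minimal and maximal elements of $U$ (empty if $U$ is empty). ${\uparrow}x=\{y\in\mathbf P: y\ge x\}$, ${\downarrow}x=\{y\in\mathbf P:y\le x\}$, ${\uparrow}I=\bigcup_{x\in I}{\uparrow}x$, ${\downarrow}I=\bigcup_{x\in I}{\downarrow}x$, ${\Uparrow}I={\uparrow}I\setminus I$, ${\Downarrow}I={\downarrow}I\setminus I$. For a two-element subset $\mathbf a$ of a totally ordered set, $\underline{\mathbf a}=\min\mathbf a$ and $\overline{\mathbf a}=\max\mathbf a$ (with respect to the chosen total order). For a two-element subset $\mathbf a$ of $\mathrm{sc}(I)$ put $\vee'\mathbf a:=\mathrm{sc}({\uparrow}\underline{\mathbf a}\cap{\uparrow}\overline{\mathbf a})$ (minimal upper bounds in $\mathbf P$), and for a two-element subset $\mathbf b$ of $\mathrm{sk}(I)$ put $\wedge'\mathbf b:=\mathrm{sk}({\downarrow}\underline{\mathbf b}\cap{\downarrow}\overline{\mathbf b})$ (maximal lower bounds in $\mathbf P$). Then $\mathrm{sc}_1(I)=\{\mathbf a_c:=(\mathbf a,c)\mid \mathbf a\subseteq\mathrm{sc}(I),|\mathbf a|=2,c\in\vee'\mathbf a\}$ and $\mathrm{sk}_1(I)=\{\mathbf b_d:=(\mathbf b,d)\mid\mathbf b\subseteq\mathrm{sk}(I),|\mathbf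 b|=2,d\in\wedge'\mathbf b\}$ (disjoint unions). A choice map $\mathbf c\colon\mathrm{sc}({\Uparrow}I)\to\mathrm{sc}(I)$ is any map with $\mathbf c(a')\le a'$ for all $a'$; a choice map $\mathbf d\colon\mathrm{sk}({\Downarrow}I)\to\mathrm{sk}(I)$ is any map with $\mathbf d(b')\ge b'$ for all $b'$. $\delta$ is the Kronecker delta. In the matrices, a column index $a\in\mathrm{sc}(I)$, $b'\in\mathrm{sk}({\Downarrow}I)$, $\mathbf b_d\in\mathrm{sk}_1(I)$ corresponds to a source summand $M(a)$, $M(b')$, $M(d)$ respectively, and a row index $\mathbf a_c$, $a'$, $b$ to a target summand $M(c)$, $M(a')$, $M(b)$. *)

theory Defs
  imports Complex_Main "HOL-Library.Function_Algebras"
begin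

section \<open>Modules over a poset\<close>

text \<open>
  The finite poset is the carrier of a type \<open>'p\<close> of classes \<^class>\<open>order\<close> and
  \<^class>\<open>finite\<close>, the field is a type \<open>'k\<close> of class \<^class>\<open>field\<close>.
  A functor \<open>M\<close> to finite-dimensional vector spaces assigns to \<open>x\<close> a finite-dimensional subspace
  \<open>M(x) = obj M x\<close> of an arbitrary vector space (type \<open>'v\<close>, scalar multiplication \<open>s\<close>); the
  dimension of \<open>'v\<close> is not restricted, and the \<open>M(x)\<close> may overlap or coincide without any
  relation between their structure maps. The structure map \<open>M\<^sub>y\<^sub>,\<^sub>x : M(x) \<rightarrow> M(y)\<close> is
  \<open>mor M y x\<close>; only its values on \<open>M(x)\<close> for \<open>x \<le> y\<close> are meaningful.
\<close>

record ('p, 'v) pmod =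
  obj :: "'p \<Rightarrow> 'v set"
  mor :: "'p \<Rightarrow> 'p \<Rightarrow> 'v \<Rightarrow> 'v"

definition lin_map_on ::
  "('k \<Rightarrow> 'v::ab_group_add \<Rightarrow> 'v) \<Rightarrow> ('k \<Rightarrow> 'w::ab_group_add \<Rightarrow> 'w)
    \<Rightarrow> 'v set \<Rightarrow> 'w set \<Rightarrow> ('v \<Rightarrow> 'w) \<Rightarrow> bool" where
  "lin_map_on s t V W f \<longleftrightarrow>
     (\<forall>v\<in>V. f v \<in> W) \<and>
     (\<forall>v\<in>V. \<forall>v'\<in>V. f (v + v') = f v + f v') \<and>
     (\<forall>k. \<forall>v\<in>V. f (s k v) = t k (f v))"

locale pmodule = vector_space s
  for s :: "'k::field \<Rightarrow> 'v::ab_group_add \<Rightarrow> 'v" +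
  fixes M :: "('p::{order,finite}, 'v) pmod"
  assumes subspace_obj: "subspace (obj M x)"
    and finite_dim_obj: "\<exists>B. finite B \<and> span B = obj M x"
    and linear_mor: "x \<le> y \<Longrightarrow> lin_map_on s s (obj M x) (obj M y) (mor M y x)"
    and mor_id: "v \<in> obj M x \<Longrightarrow> mor M x x v = v"
    and mor_comp: "x \<le> y \<Longrightarrow> y \<le> z \<Longrightarrow> v \<in> obj M x \<Longrightarrow> mor M z y (mor M y x v) = mor M z x v"

definition pmod_iso ::
  "('k \<Rightarrow> 'v::ab_group_add \<Rightarrow> 'v) \<Rightarrow> ('p::order, 'v) pmod
    \<Rightarrow> ('k \<Rightarrow> 'w::ab_group_add \<Rightarrow> 'w) \<Rightarrow> ('p, 'w) pmod \<Rightarrow> bool" where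
  "pmod_iso s M t N \<longleftrightarrow> (\<exists>\<phi>.
     (\<forall>x. lin_map_on s t (obj M x) (obj N x) (\<phi> x) \<and> bij_betw (\<phi> x) (obj M x) (obj N x)) \<and>
     (\<forall>x y. x \<le> y \<longrightarrow> (\<forall>v\<in>obj M x. \<phi> y (mor M y x v) = mor N y x (\<phi> x v))))"


section \<open>Decompositions into indecomposables and multiplicities\<close>

text \<open>A submodule is given by its family of subspaces; its structure maps are those of \<open>M\<close>.\<close>

definition submod ::
  "('k::field \<Rightarrow> 'v::ab_group_add \<Rightarrow> 'v) \<Rightarrow> ('p::order, 'v) pmod \<Rightarrow> ('p \<Rightarrow> 'v set) \<Rightarrow> bool" where
  "submod s M U \<longleftrightarrow>
     (\<forall>x. module.subspace s (U x) \<and> U x \<subseteq> obj M x) \<and>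
     (\<forall>x y. x \<le> y \<longrightarrow> mor M y x ` U x \<subseteq> U y)"

definition restr :: "('p, 'v) pmod \<Rightarrow> ('p \<Rightarrow> 'v set) \<Rightarrow> ('p, 'v) pmod" where
  "restr M U = \<lparr>obj = U, mor = mor M\<rparr>"

text \<open>\<open>M\<close> is the (internal) direct sum of \<open>U 0, \<dots>, U (n - 1)\<close>.\<close>

definition direct_sum ::
  "('k::field \<Rightarrow> 'v::ab_group_add \<Rightarrow> 'v) \<Rightarrow> ('p::order, 'v) pmod
    \<Rightarrow> nat \<Rightarrow> (nat \<Rightarrow> 'p \<Rightarrow> 'v set) \<Rightarrow> bool" where
  "direct_sum s M n U \<longleftrightarrow>
     (\<forall>j<n. submod s M (U j)) \<and>
     (\<forall>x. \<forall>v\<in>obj M x.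
        \<exists>!u. (\<forall>j<n. u j \<in> U j x) \<and> (\<forall>j\<ge>n. u j = 0) \<and> v = (\<Sum>j<n. u j))"

definition indecomposable ::
  "('k::field \<Rightarrow> 'v::ab_group_add \<Rightarrow> 'v) \<Rightarrow> ('p::order, 'v) pmod \<Rightarrow> bool" where
  "indecomposable s M \<longleftrightarrow>
     (\<exists>x. obj M x \<noteq> {0}) \<and>
     (\<forall>U. direct_sum s M 2 U \<longrightarrow> (\<exists>j<2. \<forall>x. U j x = {0}))"

definition indec_decomposition ::
  "('k::field \<Rightarrow> 'v::ab_group_add \<Rightarrow> 'v) \<Rightarrow> ('p::order, 'v) pmod
    \<Rightarrow> nat \<Rightarrow> (nat \<Rightarrow> 'p \<Rightarrow> 'v set) \<Rightarrow> bool" where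
  "indec_decomposition s M n U \<longleftrightarrow>
     direct_sum s M n U \<and> (\<forall>j<n. indecomposable s (restr M (U j)))"

text \<open>
  The multiplicity \<open>d\<^sub>M(V)\<close> of an indecomposable \<open>V\<close> (with scalar multiplication \<open>t\<close>): the number
  of summands isomorphic to \<open>V\<close> in a decomposition of \<open>M\<close> into indecomposables. That this number
  exists and does not depend on the decomposition is the Krull--Schmidt theorem.
\<close>

definition multiplicity ::
  "('k::field \<Rightarrow> 'v::ab_group_add \<Rightarrow> 'v) \<Rightarrow> ('p::order, 'v) pmod
    \<Rightarrow> ('k \<Rightarrow> 'w::ab_group_add \<Rightarrow> 'w) \<Rightarrow> ('p, 'w) pmod \<Rightarrow> nat" where
  "multiplicity s M t V =
     (THE m. \<exists>n U. indec_decomposition s M n U \<and>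
                   m = card {j. j < n \<and> pmod_iso s (restr M (U j)) t V})"


section \<open>Intervals and interval modules\<close>

definition interval :: "'p::order set \<Rightarrow> bool" where
  "interval I \<longleftrightarrow>
     I \<noteq> {} \<and>
     (\<forall>x\<in>I. \<forall>y\<in>I. (x, y) \<in> {(u, v). u \<in> I \<and> v \<in> I \<and> (u \<le> v \<or> v \<le> u)}\<^sup>*) \<and>
     (\<forall>x\<in>I. \<forall>y\<in>I. \<forall>z. x \<le> z \<and> z \<le> y \<longrightarrow> z \<in> I)"

text \<open>The field is regarded as a vector space over itself with scalar multiplication \<open>(*)\<close>.\<close>

definition interval_module :: "'p::order set \<Rightarrow> ('p, 'k::field) pmod" where
  "interval_module I =
     \<lparr>obj = (\<lambda>x. if x \<in> I then UNIV else {0}),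
      mor = (\<lambda>y x. if x \<le> y \<and> x \<in> I \<and> y \<in> I then (\<lambda>v. v) else (\<lambda>v. 0))\<rparr>"


section \<open>Sources, sinks and the index sets\<close>

definition sc :: "'p::order set \<Rightarrow> 'p set" where
  "sc U = {x \<in> U. \<forall>y\<in>U. y \<le> x \<longrightarrow> y = x}"

definition sk :: "'p::order set \<Rightarrow> 'p set" where
  "sk U = {x \<in> U. \<forall>y\<in>U. x \<le> y \<longrightarrow> y = x}"

definition Up :: "'p::order set \<Rightarrow> 'p set" where
  "Up I = (\<Union>x\<in>I. {x..}) - I"

definition Down :: "'p::order set \<Rightarrow> 'p set" where
  "Down I = (\<Union>x\<in>I. {..x}) - I"

text \<open>Minimum and maximum of a set with respect to a chosen total order \<open>r\<close>, where \<open>(x, y) \<in> r\<close>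
  means that \<open>x\<close> is below \<open>y\<close>. This order is unrelated to the order of the poset.\<close>

definition lo :: "'p rel \<Rightarrow> 'p set \<Rightarrow> 'p" where
  "lo r A = (THE x. x \<in> A \<and> (\<forall>y\<in>A. (x, y) \<in> r))"

definition hi :: "'p rel \<Rightarrow> 'p set \<Rightarrow> 'p" where
  "hi r A = (THE x. x \<in> A \<and> (\<forall>y\<in>A. (y, x) \<in> r))"

definition vee :: "'p::order rel \<Rightarrow> 'p set \<Rightarrow> 'p set" where
  "vee r A = sc ({lo r A..} \<inter> {hi r A..})"

definition wedge :: "'p::order rel \<Rightarrow> 'p set \<Rightarrow> 'p set" where
  "wedge q B = sk ({..lo q B} \<inter> {..hi q B})"

definition sc1 :: "'p::order rel \<Rightarrow> 'p set \<Rightarrow> ('p set \<times> 'p) set" where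
  "sc1 r I = {(A, c). A \<subseteq> sc I \<and> card A = 2 \<and> c \<in> vee r A}"

definition sk1 :: "'p::order rel \<Rightarrow> 'p set \<Rightarrow> ('p set \<times> 'p) set" where
  "sk1 q I = {(B, d). B \<subseteq> sk I \<and> card B = 2 \<and> d \<in> wedge q B}"


section \<open>Matrices of linear maps and their rank\<close>

text \<open>
  A matrix of linear maps is a function \<open>A\<close> of a row index and a column index. If \<open>S c\<close> is the
  source summand of column \<open>c\<close>, the matrix with rows \<open>R\<close> and columns \<open>C\<close> acts on the direct sum of
  the \<open>S c\<close>; its rank is the dimension of the image in the space of families indexed by \<open>R\<close>
  (families of vectors are functions that vanish outside the index set).
\<close>

definition fam_scale :: "('k \<Rightarrow> 'v \<Rightarrow> 'v) \<Rightarrow> 'k \<Rightarrow> ('r \<Rightarrow> 'v) \<Rightarrow> 'r \<Rightarrow> 'v" where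
  "fam_scale s k w = (\<lambda>i. s k (w i))"

definition mat_apply ::
  "'r set \<Rightarrow> 'c set \<Rightarrow> ('r \<Rightarrow> 'c \<Rightarrow> 'v \<Rightarrow> 'v::ab_group_add) \<Rightarrow> ('c \<Rightarrow> 'v) \<Rightarrow> 'r \<Rightarrow> 'v" where
  "mat_apply R C A u = (\<lambda>i. if i \<in> R then (\<Sum>c\<in>C. A i c (u c)) else 0)"

definition mat_rank ::
  "('k::field \<Rightarrow> 'v::ab_group_add \<Rightarrow> 'v) \<Rightarrow> 'r set \<Rightarrow> 'c set \<Rightarrow> ('c \<Rightarrow> 'v set)
    \<Rightarrow> ('r \<Rightarrow> 'c \<Rightarrow> 'v \<Rightarrow> 'v) \<Rightarrow> nat" where
  "mat_rank s R C S A =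
     vector_space.dim (fam_scale s) (mat_apply R C A ` {u. \<forall>c\<in>C. u c \<in> S c})"

definition zero_block :: "'r \<Rightarrow> 'c \<Rightarrow> 'v \<Rightarrow> 'v::ab_group_add" where
  "zero_block = (\<lambda>i c v. 0)"

text \<open>Block matrices with three block rows and three block columns, indexed by disjoint unions.\<close>

datatype ('a, 'b, 'c) blk = B1 'a | B2 'b | B3 'c

definition blk_sets :: "'a set \<Rightarrow> 'b set \<Rightarrow> 'c set \<Rightarrow> ('a, 'b, 'c) blk set" where
  "blk_sets X Y Z = B1 ` X \<union> B2 ` Y \<union> B3 ` Z"

definition blk_row ::
  "('c1 \<Rightarrow> 'e) \<Rightarrow> ('c2 \<Rightarrow> 'e) \<Rightarrow> ('c3 \<Rightarrow> 'e) \<Rightarrow> ('c1, 'c2, 'c3) blk \<Rightarrow> 'e" where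
  "blk_row f g h j = (case j of B1 x \<Rightarrow> f x | B2 y \<Rightarrow> g y | B3 z \<Rightarrow> h z)"

definition block_matrix ::
  "('r1 \<Rightarrow> 'c1 \<Rightarrow> 'e) \<Rightarrow> ('r1 \<Rightarrow> 'c2 \<Rightarrow> 'e) \<Rightarrow> ('r1 \<Rightarrow> 'c3 \<Rightarrow> 'e) \<Rightarrow>
   ('r2 \<Rightarrow> 'c1 \<Rightarrow> 'e) \<Rightarrow> ('r2 \<Rightarrow> 'c2 \<Rightarrow> 'e) \<Rightarrow> ('r2 \<Rightarrow> 'c3 \<Rightarrow> 'e) \<Rightarrow>
   ('r3 \<Rightarrow> 'c1 \<Rightarrow> 'e) \<Rightarrow> ('r3 \<Rightarrow> 'c2 \<Rightarrow> 'e) \<Rightarrow> ('r3 \<Rightarrow> 'c3 \<Rightarrow> 'e) \<Rightarrow>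
   ('r1, 'r2, 'r3) blk \<Rightarrow> ('c1, 'c2, 'c3) blk \<Rightarrow> 'e" where
  "block_matrix A11 A12 A13 A21 A22 A23 A31 A32 A33 i =
     (case i of
        B1 x \<Rightarrow> blk_row (A11 x) (A12 x) (A13 x)
      | B2 y \<Rightarrow> blk_row (A21 y) (A22 y) (A23 y)
      | B3 z \<Rightarrow> blk_row (A31 z) (A32 z) (A33 z))"


section \<open>The blocks\<close>

definition matM1 ::
  "('p, 'v::ab_group_add) pmod \<Rightarrow> 'p rel \<Rightarrow> 'p set \<times> 'p \<Rightarrow> 'p \<Rightarrow> 'v \<Rightarrow> 'v" where
  "matM1 M r = (\<lambda>(A, c) a.
     if a \<notin> A then (\<lambda>v. 0)
     else if a = lo r A then mor M c a
     else if a = hi r A then (\<lambda>v. - mor M c a v)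
     else (\<lambda>v. 0))"

definition matM2 :: "('p, 'v::ab_group_add) pmod \<Rightarrow> ('p \<Rightarrow> 'p) \<Rightarrow> 'p \<Rightarrow> 'p \<Rightarrow> 'v \<Rightarrow> 'v" where
  "matM2 M cm a' a = (if a = cm a' then mor M a' (cm a') else (\<lambda>v. 0))"

definition matM3 :: "('p, 'v::ab_group_add) pmod \<Rightarrow> 'p \<Rightarrow> 'p \<Rightarrow> 'p \<Rightarrow> 'p \<Rightarrow> 'v \<Rightarrow> 'v" where
  "matM3 M b0 a0 b a = (if b = b0 \<and> a = a0 then mor M b0 a0 else (\<lambda>v. 0))"

definition matM4 :: "('p, 'v::ab_group_add) pmod \<Rightarrow> ('p \<Rightarrow> 'p) \<Rightarrow> 'p \<Rightarrow> 'p \<Rightarrow> 'v \<Rightarrow> 'v" where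
  "matM4 M dm b b' = (if b = dm b' then mor M (dm b') b' else (\<lambda>v. 0))"

definition matM5 ::
  "('p, 'v::ab_group_add) pmod \<Rightarrow> 'p rel \<Rightarrow> 'p \<Rightarrow> 'p set \<times> 'p \<Rightarrow> 'v \<Rightarrow> 'v" where
  "matM5 M q b = (\<lambda>(B, d).
     if b \<notin> B then (\<lambda>v. 0)
     else if b = lo q B then mor M b d
     else if b = hi q B then (\<lambda>v. - mor M b d v)
     else (\<lambda>v. 0))"


section \<open>The two matrices\<close>

definition row_idx :: "'p::order rel \<Rightarrow> 'p set \<Rightarrow> ('p set \<times> 'p, 'p, 'p) blk set" where
  "row_idx r I = blk_sets (sc1 r I) (sc (Up I)) (sk I)"

definition col_idx :: "'p::order rel \<Rightarrow> 'p set \<Rightarrow> ('p, 'p, 'p set \<times> 'p) blk set" where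
  "col_idx q I = blk_sets (sc I) (sk (Down I)) (sk1 q I)"

definition col_src :: "('p, 'v) pmod \<Rightarrow> ('p, 'p, 'p set \<times> 'p) blk \<Rightarrow> 'v set" where
  "col_src M = blk_row (\<lambda>a. obj M a) (\<lambda>b'. obj M b') (\<lambda>(B, d). obj M d)"

end

theory Submission
  imports Defs
begin

text \<open>
  A family killed by the upper blocks \<open>M\<^sub>1, M\<^sub>2\<close> is the same as a morphism \<open>f : V\<^sub>I \<rightarrow> M\<close>, and a linear
  functional killing the image of \<open>M\<^sub>4, M\<^sub>5\<close> is the same as a morphism \<open>g : M \<rightarrow> V\<^sub>I\<close>. Hence the
  difference of the two ranks is the rank of the pairing \<open>(f, g) \<mapsto> g \<circ> f \<in> End V\<^sub>I = k\<close>, read off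
  at \<open>b\<^sub>*\<close>. This rank is additive over direct sums; an indecomposable summand contributes \<open>1\<close> if it is
  isomorphic to \<open>V\<^sub>I\<close> and \<open>0\<close> otherwise, because a nonzero composite \<open>V\<^sub>I \<rightarrow> U \<rightarrow> V\<^sub>I\<close> splits \<open>V\<^sub>I\<close> off \<open>U\<close>.
  Since the ranks do not mention a decomposition, this also gives the uniqueness of the multiplicity.
\<close>

section \<open>Linear algebra\<close>

text \<open>Both matrices have the same upper rows, so forgetting the bottom block row reduces the
  difference of ranks to the difference of the two kernels of that projection. Without
  \<open>matM3\<close> the kernel is \<open>low_image\<close>, the column space of M4 and M5; with
  it the kernel also contains the vectors \<open>f b0\<close>, because \<open>mor M b0 a0\<close>
  sends \<open>f a0\<close> to \<open>f b0\<close>. The number sought is thus the dimension spanned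
  by the classes of all \<open>f b0\<close> modulo \<open>low_image\<close>, and a class is nonzero
  exactly when some g detects it. Minimal upper bounds suffice in M1 because every common upper
  bound of two sources lies above one of them. The choice maps are arbitrary because, once the
  values pushed forward from all sources agree, one vanishing condition per minimal element of
  \<open>Up I\<close> is enough. Connectedness makes g o f a single scalar, so any b0 sees it. The
  ambient type may have infinite dimension and the spaces of M are mere subspaces of it. Hence
  structure maps are linear only on carriers, and finiteness of dimension is a property of the sets
  of vectors that occur.\<close>

lemma vector_space_mult: "vector_space ((*) :: 'k::field \<Rightarrow> 'k \<Rightarrow> 'k)"
  by unfold_locales (auto simp: algebra_simps)

lemma sum_fun_apply: "(\<Sum>i\<in>A. f i) x = (\<Sum>i\<in>A. f i x)"
  by (induction A rule: infinite_finite_induct) auto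

section \<open>Maps that are linear on a subspace only\<close>

lemma lin_map_onD:
  assumes "lin_map_on s t V W f"
  shows "v \<in> V \<Longrightarrow> f v \<in> W"
    and "v \<in> V \<Longrightarrow> v' \<in> V \<Longrightarrow> f (v + v') = f v + f v'"
    and "v \<in> V \<Longrightarrow> f (s k v) = t k (f v)"
  using assms by (auto simp: lin_map_on_def)

lemma lin_map_on_compose:
  assumes "lin_map_on s t V W f" "lin_map_on t u W X g"
  shows "lin_map_on s u V X (\<lambda>v. g (f v))"
  using assms by (auto simp: lin_map_on_def)

lemma lin_map_on_subset:
  assumes "lin_map_on s t V W f" "V' \<subseteq> V" "W \<subseteq> W'"
  shows "lin_map_on s t V' W' f"
  using assms unfolding lin_map_on_def by (meson subsetD)

text \<open>Being covered by a finite span, rather than being one, passes to all subsets; in an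
  ambient space of unrestricted dimension this is what keeps \<open>dim\<close> meaningful.\<close>

definition (in vector_space) findim :: "'b set \<Rightarrow> bool" where
  "findim S \<longleftrightarrow> (\<exists>F. finite F \<and> S \<subseteq> span F)"

lemma (in vector_space) findim_subset: "findim T \<Longrightarrow> S \<subseteq> T \<Longrightarrow> findim S"
  unfolding findim_def by blast

lemma (in vector_space) findim_basis:
  assumes "findim S"
  obtains B where "B \<subseteq> S" "finite B" "independent B" "S \<subseteq> span B" "card B = dim S"
proof -
  obtain F where F: "finite F" "S \<subseteq> span F"
    using assms by (auto simp: findim_def)
  obtain B where B: "B \<subseteq> S" "independent B" "S \<subseteq> span B" "card B = dim S"
    using basis_exists[of S] by metis
  then have "finite B"
    using independent_span_bound[OF F(1) B(2)] F(2) by blast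
  with B that show ?thesis by blast
qed

lemma (in vector_space) lin_map_on_zero:
  assumes "lin_map_on scale t V W f" "subspace V"
  shows "f 0 = 0"
proof -
  have "f (0 + 0) = f 0 + f 0"
    using lin_map_onD(2)[OF assms(1)] subspace_0[OF assms(2)] by blast
  then show ?thesis by simp
qed

lemma (in vector_space) lin_map_on_sum:
  assumes "lin_map_on scale t V W f" "subspace V" "\<And>i. i \<in> A \<Longrightarrow> v i \<in> V"
  shows "f (\<Sum>i\<in>A. v i) = (\<Sum>i\<in>A. f (v i))"
  using assms(3)
proof (induction A rule: infinite_finite_induct)
  case (insert i A)
  then have "(\<Sum>i\<in>A. v i) \<in> V"
    by (intro subspace_sum[OF assms(2)]) auto
  with insert show ?case
    by (simp add: lin_map_onD(2)[OF assms(1)])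
qed (use lin_map_on_zero[OF assms(1,2)] in auto)

lemma (in vector_space) lin_map_on_diff:
  assumes "lin_map_on scale t V W f" "subspace V" "v \<in> V" "w \<in> V"
  shows "f (v - w) = f v - f w"
proof -
  have "f ((v - w) + w) = f (v - w) + f w"
    using assms by (intro lin_map_onD(2)[OF assms(1)] subspace_diff)
  then show ?thesis by (simp add: algebra_simps)
qed

lemma (in vector_space) lin_map_on_kernel:
  assumes "lin_map_on scale t V W f" "subspace V" "vector_space t"
  shows "subspace {v \<in> V. f v = 0}"
proof -
  interpret t: vector_space t by fact
  show ?thesis
    using assms(2) lin_map_on_zero[OF assms(1,2)] lin_map_onD[OF assms(1)]
    by (auto intro!: subspaceI simp: subspace_0 subspace_add subspace_scale)
qed

lemma (in vector_space) lin_map_on_image: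
  assumes "lin_map_on scale t V W f" "subspace V" "vector_space t"
  shows "module.subspace t (f ` V)"
proof -
  interpret t: vector_space t by fact
  show ?thesis
  proof (rule t.subspaceI)
    show "0 \<in> f ` V"
      using lin_map_on_zero[OF assms(1,2)] subspace_0[OF assms(2)] by force
  next
    fix x y assume "x \<in> f ` V" "y \<in> f ` V"
    then obtain v w where "v \<in> V" "w \<in> V" "x = f v" "y = f w" by blast
    then show "x + y \<in> f ` V"
      using lin_map_onD(2)[OF assms(1)] subspace_add[OF assms(2)] by (metis imageI)
  next
    fix k x assume "x \<in> f ` V"
    then obtain v where "v \<in> V" "x = f v" by blast
    then show "t k x \<in> f ` V"
      using lin_map_onD(3)[OF assms(1)] subspace_scale[OF assms(2)] by (metis imageI)
  qed
qed

text \<open>The functionals dual to \<open>w\<close> vanish on S, so they prove \<open>w\<close>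
  independent modulo S. Linearity is asked on V alone because in the final count the functionals
  come from module morphisms, which are linear only on carriers. Rank-nullity is the other
  application.\<close>

lemma (in vector_space) dim_span_Un_dual:
  assumes V: "subspace V" and S: "S \<subseteq> V" "findim S" and J: "finite J"
    and w: "\<And>j. j \<in> J \<Longrightarrow> w j \<in> V"
    and G: "\<And>j. j \<in> J \<Longrightarrow> lin_map_on scale (*) V UNIV (G j)"
    and G0: "\<And>j v. j \<in> J \<Longrightarrow> v \<in> S \<Longrightarrow> G j v = 0"
    and Gw: "\<And>i j. i \<in> J \<Longrightarrow> j \<in> J \<Longrightarrow> G i (w j) = (if i = j then 1 else 0)"
  shows "dim (span (S \<union> w ` J)) = dim S + card J"
proof -
  obtain B where B: "B \<subseteq> S" "finite B" "independent B" "S \<subseteq> span B" "card B = dim S"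
    using S(2) by (rule findim_basis)
  have *: "independent (B \<union> w ` J') \<and> card (B \<union> w ` J') = card B + card J'" if "J' \<subseteq> J" for J'
    using finite_subset[OF that J] that
  proof (induction J' rule: finite_induct)
    case empty
    then show ?case using B by simp
  next
    case (insert j J')
    \<comment> \<open>All vectors collected so far lie in the kernel of \<open>G j\<close>, whereas
      \<open>w j\<close> has value 1; hence \<open>w j\<close> is not in their span.\<close>
    let ?K = "{v \<in> V. G j v = 0}"
    have "span (B \<union> w ` J') \<subseteq> ?K"
    proof (rule span_minimal)
      show "subspace ?K"
        using insert.prems by (intro lin_map_on_kernel[OF G V] vector_space_mult) auto
      show "B \<union> w ` J' \<subseteq> ?K"
      proof -
        have "B \<subseteq> ?K"
          using B(1) S(1) G0[of j] insert.prems by blast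
        moreover have "w i \<in> ?K" if "i \<in> J'" for i
          using that insert.hyps(2) insert.prems w[of i] Gw[of j i] by auto
        ultimately show ?thesis by blast
      qed
    qed
    moreover have "G j (w j) = 1"
      using insert.prems Gw[of j j] by simp
    ultimately have nin: "w j \<notin> span (B \<union> w ` J')"
      by force
    then have "w j \<notin> B \<union> w ` J'"
      using span_base[of "w j" "B \<union> w ` J'"] by metis
    with insert B(2) nin show ?case
      by (simp add: independent_insert)
  qed
  have "span (S \<union> w ` J) = span (B \<union> w ` J)"
  proof
    have "S \<subseteq> span (B \<union> w ` J)"
      using B(4) span_mono[of B "B \<union> w ` J"] by blast
    then show "span (S \<union> w ` J) \<subseteq> span (B \<union> w ` J)"
      by (intro span_minimal subspace_span) (auto intro: span_base)
    show "span (B \<union> w ` J) \<subseteq> span (S \<union> w ` J)"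
      using B(1) by (intro span_mono) auto
  qed
  then show ?thesis
    using *[of J] B(5) by (simp add: dim_eq_card_independent)
qed

text \<open>Lifts of a basis of the image, together with the kernel, span S. The coordinates of
  \<open>f v\<close> in that basis are functionals that are dual to the lifts and vanish on the
  kernel, so \<open>dim_span_Un_dual\<close> does the count.\<close>

lemma (in vector_space) dim_kernel_image:
  assumes S: "subspace S" "findim S" and f: "module_hom scale scale f"
  shows "dim S = dim {v \<in> S. f v = 0} + dim (f ` S)"
proof -
  interpret f: module_hom scale scale f by fact
  let ?K = "{v \<in> S. f v = 0}"
  obtain F where F: "finite F" "S \<subseteq> span F"
    using S(2) by (auto simp: findim_def)
  have "findim (f ` S)"
    unfolding findim_def using F by (intro exI[of _ "f ` F"]) (auto simp: f.span_image)
  then obtain B where B: "B \<subseteq> f ` S" "finite B" "independent B" "f ` S \<subseteq> span B"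
      "card B = dim (f ` S)"
    by (rule findim_basis)
  have "\<forall>b\<in>B. \<exists>v. v \<in> S \<and> f v = b"
    using B(1) by blast
  then obtain l where l: "\<And>b. b \<in> B \<Longrightarrow> l b \<in> S \<and> f (l b) = b"
    by metis
  define G where "G = (\<lambda>b v. representation B (f v) b)"
  have "S = span (?K \<union> l ` B)"
  proof
    show "span (?K \<union> l ` B) \<subseteq> S"
      using l S(1) by (intro span_minimal) auto
    show "S \<subseteq> span (?K \<union> l ` B)"
    proof
      fix v assume v: "v \<in> S"
      have "f ` l ` B = B" using l by force
      then have "f v \<in> f ` span (l ` B)"
        using v B(4) f.span_image[of "l ` B"] by auto
      then obtain y where y: "y \<in> span (l ` B)" "f v = f y" by blast
      have "span (l ` B) \<subseteq> S"
        using l S(1) by (intro span_minimal) auto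
      with y v have "v - y \<in> ?K"
        using S(1) by (auto intro: subspace_diff simp: f.diff)
      then have "(v - y) + y \<in> span (?K \<union> l ` B)"
        using y(1) span_mono[of "l ` B" "?K \<union> l ` B"] by (intro span_add) (auto intro: span_base)
      then show "v \<in> span (?K \<union> l ` B)" by simp
    qed
  qed
  then have "dim S = dim (span (?K \<union> l ` B))" by simp
  also have "\<dots> = dim ?K + card B"
  proof (rule dim_span_Un_dual[OF S(1), where G = G])
    show "findim ?K" using S(2) by (rule findim_subset) auto
    fix b assume b: "b \<in> B"
    show "lin_map_on scale (*) S UNIV (G b)"
      using B(3,4) unfolding G_def lin_map_on_def
      by (auto simp: f.add f.scale representation_add representation_scale subset_iff)
    show "G b v = 0" if "v \<in> ?K" for v
      using that by (simp add: G_def representation_zero)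
    show "G b (l j) = (if b = j then 1 else 0)" if "j \<in> B" for j
      using that l B(3) by (simp add: G_def representation_basis)
  qed (use l B in auto)
  finally show ?thesis using B(5) by simp
qed

text \<open>A basis of S extends to a basis of T. The strict version drives the induction in
  \<open>indec_decomposition_exists\<close>.\<close>

lemma (in vector_space) dim_psubset_subspace:
  assumes "subspace S" "S \<subseteq> T" "findim T"
  shows "dim S \<le> dim T" and "T \<noteq> S \<Longrightarrow> dim S < dim T"
proof -
  obtain B where B: "B \<subseteq> S" "finite B" "independent B" "S \<subseteq> span B" "card B = dim S"
    using findim_basis[OF findim_subset[OF assms(3,2)]] by blast
  obtain C where C: "B \<subseteq> C" "C \<subseteq> T" "independent C" "T \<subseteq> span C"
    using maximal_independent_subset_extend[of B T] B assms(2) by blast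
  have "finite C"
    using independent_span_bound[OF _ C(3)] C(2) assms(3) unfolding findim_def by blast
  moreover have dimT: "card C = dim T"
    using C basis_card_eq_dim by blast
  ultimately show "dim S \<le> dim T"
    using C(1) B(5) card_mono by metis
  assume "T \<noteq> S"
  have "B \<noteq> C"
  proof
    assume "B = C"
    then have "T \<subseteq> S" using C(4) B(1) assms(1) span_minimal by blast
    with \<open>T \<noteq> S\<close> assms(2) show False by blast
  qed
  then show "dim S < dim T"
    using C(1) B(5) dimT \<open>finite C\<close> psubset_card_mono[of C B] by auto
qed

text \<open>Adding v to a basis of S keeps it independent, so the values 0 on the basis and 1 at v
  extend linearly to the whole space, whatever its dimension. This detects that a vector of the
  bottom rows is outside \<open>low_image\<close>.\<close>

lemma (in vector_space) separating_functional:
  assumes "subspace S" "v \<notin> S"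
  shows "\<exists>G. lin_map_on scale (*) UNIV UNIV G \<and> (\<forall>x\<in>S. G x = 0) \<and> G v = (1::'a)"
proof -
  obtain B where B: "B \<subseteq> S" "independent B" "S \<subseteq> span B"
    using basis_exists[of S] by metis
  have nin: "v \<notin> span B"
    using subsetD[OF span_minimal[OF B(1) assms(1)]] assms(2) by metis
  then have v: "v \<notin> B"
    using span_base[of v B] by metis
  then have ind: "independent (insert v B)"
    using B(2) nin by (simp add: independent_insert)
  interpret p: vector_space_pair scale "(*) :: 'a \<Rightarrow> 'a \<Rightarrow> 'a"
    by (rule vector_space_pair.intro[OF vector_space_axioms vector_space_mult])
  obtain G where G: "Vector_Spaces.linear scale (*) G"
      "\<forall>x\<in>insert v B. G x = (if x = v then 1 else 0)"
    using p.linear_independent_extend[OF ind, of "\<lambda>x. if x = v then 1 else 0"] by blast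
  interpret G: Vector_Spaces.linear scale "(*)" G by fact
  have "G b = 0" if "b \<in> B" for b
    using that v G(2) by (metis insertI2)
  then have "G x = 0" if "x \<in> span B" for x
    using that by (rule G.eq_0_on_span)
  moreover have "lin_map_on scale (*) UNIV UNIV G"
    by (simp add: lin_map_on_def G.add G.scale)
  moreover have "G v = 1"
    using G(2) by simp
  ultimately show ?thesis
    using B(3) by blast
qed

section \<open>Families of vectors\<close>

lemma (in vector_space) vector_space_fam_scale: "vector_space (fam_scale scale :: 'a \<Rightarrow> ('r \<Rightarrow> 'b) \<Rightarrow> _)"
  by unfold_locales (auto simp: fam_scale_def fun_eq_iff scale_right_distrib scale_left_distrib)

text \<open>The inclusion of the summand with index i; it serves source and target families
  alike.\<close>

definition single :: "'r \<Rightarrow> 'v::zero \<Rightarrow> 'r \<Rightarrow> 'v" where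
  "single i v = (\<lambda>k. if k = i then v else 0)"

lemma single_apply [simp]: "single i v i = v" "k \<noteq> i \<Longrightarrow> single i v k = 0"
  by (auto simp: single_def)

lemma single_zero: "single i 0 = 0"
  by (auto simp: single_def)

lemma single_add: "single i (v + w) = single i v + single i (w :: 'v::monoid_add)"
  by (auto simp: single_def)

lemma single_sum: "single i (\<Sum>a\<in>A. v a) = (\<Sum>a\<in>A. single i (v a :: 'v::ab_group_add))"
  by (induction A rule: infinite_finite_induct) (auto simp: single_zero single_add)

lemma (in vector_space) single_scale: "single i (scale k v) = fam_scale scale k (single i v)"
  by (auto simp: single_def fam_scale_def)

text \<open>A family is the sum of its coordinate inclusions, so the images of finite spanning sets
  span. Vanishing outside R matters: free entries would range over a space of unrestricted
  dimension.\<close>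

lemma (in vector_space) findim_families:
  assumes "finite R" "\<And>i. i \<in> R \<Longrightarrow> findim (V i)"
  shows "vector_space.findim (fam_scale scale)
    {w. (\<forall>i\<in>R. w i \<in> V i) \<and> (\<forall>i. i \<notin> R \<longrightarrow> w i = 0)}"
proof -
  interpret fam: vector_space "fam_scale scale :: 'a \<Rightarrow> ('c \<Rightarrow> 'b) \<Rightarrow> _"
    by (rule vector_space_fam_scale)
  obtain F where F: "\<And>i. i \<in> R \<Longrightarrow> finite (F i) \<and> V i \<subseteq> span (F i)"
    using assms(2) unfolding findim_def by metis
  define E where "E = (\<Union>i\<in>R. single i ` F i)"
  have "w \<in> fam.span E" if w: "\<forall>i\<in>R. w i \<in> V i" "\<forall>i. i \<notin> R \<longrightarrow> w i = 0" for w
  proof -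
    have "w = (\<Sum>i\<in>R. single i (w i))"
    proof
      fix j
      have "(\<Sum>i\<in>R. single i (w i) j) = (\<Sum>i\<in>R. if i = j then w j else 0)"
        by (intro sum.cong) (auto simp: single_def)
      then show "w j = (\<Sum>i\<in>R. single i (w i)) j"
        using assms(1) w(2) by (simp add: sum_fun_apply)
    qed
    moreover have "single i (w i) \<in> fam.span E" if i: "i \<in> R" for i
    proof -
      have "module_hom scale (fam_scale scale) (single i :: 'b \<Rightarrow> _)"
        unfolding module_hom_iff_linear Vector_Spaces.linear_iff
        using vector_space_axioms fam.vector_space_axioms by (simp add: single_add single_scale)
      then interpret h: module_hom scale "fam_scale scale" "single i :: 'b \<Rightarrow> _" .
      have "single i (w i) \<in> fam.span (single i ` F i)"
        using F[OF i] w(1) i by (auto simp: h.span_image)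
      then show ?thesis
        using fam.span_mono[of "single i ` F i" E] i by (auto simp: E_def)
    qed
    ultimately show ?thesis
      by (metis (no_types, lifting) fam.span_sum)
  qed
  moreover have "finite E"
    using F assms(1) by (auto simp: E_def)
  ultimately show ?thesis
    unfolding fam.findim_def by (intro exI[of _ E]) auto
qed

lemma (in vector_space) lin_map_on_mat_apply:
  assumes "\<And>i c. i \<in> R \<Longrightarrow> c \<in> C \<Longrightarrow> lin_map_on scale scale (S c) (W i) (A i c)"
    and "\<And>i. i \<in> R \<Longrightarrow> subspace (W i)"
  shows "lin_map_on (fam_scale scale) (fam_scale scale) {u. \<forall>c\<in>C. u c \<in> S c}
    {w. (\<forall>i\<in>R. w i \<in> W i) \<and> (\<forall>i. i \<notin> R \<longrightarrow> w i = 0)} (mat_apply R C A)"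
  unfolding lin_map_on_def
proof (intro conjI ballI allI)
  fix u assume u: "u \<in> {u. \<forall>c\<in>C. u c \<in> S c}"
  show "mat_apply R C A u \<in> {w. (\<forall>i\<in>R. w i \<in> W i) \<and> (\<forall>i. i \<notin> R \<longrightarrow> w i = 0)}"
    using u assms(2) lin_map_onD(1)[OF assms(1)]
    by (auto simp: mat_apply_def intro!: subspace_sum)
  show "mat_apply R C A (fam_scale scale k u) = fam_scale scale k (mat_apply R C A u)" for k
    using u lin_map_onD(3)[OF assms(1)]
    by (auto simp: mat_apply_def fam_scale_def fun_eq_iff scale_sum_right intro!: sum.cong)
  fix v assume v: "v \<in> {u. \<forall>c\<in>C. u c \<in> S c}"
  show "mat_apply R C A (u + v) = mat_apply R C A u + mat_apply R C A v"
    using u v lin_map_onD(2)[OF assms(1)]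
    by (auto simp: mat_apply_def fun_eq_iff sum.distrib[symmetric] intro!: sum.cong)
qed


section \<open>Morphisms from and to an interval module\<close>

text \<open>A morphism from the interval module is determined by the images \<open>f x\<close> of 1.
  Outside I the interval module is 0, so naturality is stated only for x in I and the values of f
  elsewhere are left free.\<close>

definition from_interval :: "('p::order, 'v::zero) pmod \<Rightarrow> 'p set \<Rightarrow> ('p \<Rightarrow> 'v) \<Rightarrow> bool" where
  "from_interval M I f \<longleftrightarrow>
     (\<forall>x\<in>I. f x \<in> obj M x) \<and>
     (\<forall>x\<in>I. \<forall>y. x \<le> y \<longrightarrow> mor M y x (f x) = (if y \<in> I then f y else 0))"

text \<open>Dually, a natural family of functionals. Naturality is imposed only at targets y in I,
  since a map into 0 is determined; a point x outside I contributes the condition that everything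
  arriving from there is killed.\<close>

definition to_interval ::
  "('k \<Rightarrow> 'v \<Rightarrow> 'v) \<Rightarrow> ('p::order, 'v::ab_group_add) pmod \<Rightarrow> 'p set
    \<Rightarrow> ('p \<Rightarrow> 'v \<Rightarrow> 'k::field) \<Rightarrow> bool" where
  "to_interval s M I g \<longleftrightarrow>
     (\<forall>x\<in>I. lin_map_on s (*) (obj M x) UNIV (g x)) \<and>
     (\<forall>x y. x \<le> y \<longrightarrow> y \<in> I \<longrightarrow>
       (\<forall>v\<in>obj M x. g y (mor M y x v) = (if x \<in> I then g x v else 0)))"

lemma from_intervalD:
  assumes "from_interval M I f" "x \<in> I"
  shows "f x \<in> obj M x"
    and "x \<le> y \<Longrightarrow> mor M y x (f x) = (if y \<in> I then f y else 0)"
  using assms by (auto simp: from_interval_def)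

lemma to_intervalD:
  assumes "to_interval s M I g" "y \<in> I"
  shows "lin_map_on s (*) (obj M y) UNIV (g y)"
    and "x \<le> y \<Longrightarrow> v \<in> obj M x \<Longrightarrow> g y (mor M y x v) = (if x \<in> I then g x v else 0)"
  using assms by (auto simp: to_interval_def)

text \<open>For x \<le> y, naturality of both maps moves the pairing: \<open>g y (f y)\<close> is g
  at y of the transported \<open>f x\<close>, hence \<open>g x (f x)\<close>. Connectedness links
  any two points by such steps; this is why an endomorphism of the interval module is a
  scalar.\<close>

lemma pairing_constant:
  assumes "interval I" "from_interval M I f" "to_interval s M I g" "x \<in> I" "y \<in> I"
  shows "g x (f x) = g y (f y)"
proof -
  have le: "g x (f x) = g y (f y)" if "x \<le> y" "x \<in> I" "y \<in> I" for x y
    using to_intervalD(2)[OF assms(3) that(3,1) from_intervalD(1)[OF assms(2) that(2)]]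
      from_intervalD(2)[OF assms(2) that(2,1)] that(2,3) by simp
  have "(x, y) \<in> {(u, v). u \<in> I \<and> v \<in> I \<and> (u \<le> v \<or> v \<le> u)}\<^sup>*"
    using assms(1)[unfolded interval_def, THEN conjunct2, THEN conjunct1] assms(4,5)
    by (metis (lifting))
  then show ?thesis
  proof (induction rule: rtrancl_induct)
    case (step y z)
    then have "y \<in> I" "z \<in> I" "y \<le> z \<or> z \<le> y" by auto
    then have "g y (f y) = g z (f z)"
      using le by metis
    with step.IH show ?case by (rule trans)
  qed simp
qed

text \<open>The isomorphism itself is g, and f collects the preimages of 1. The last two conclusions
  say that f and g are mutually inverse on I.\<close>

lemma pmod_iso_interval_moduleE:
  assumes M: "pmodule s M" and iso: "pmod_iso s M ((*) :: 'k::field \<Rightarrow> _) (interval_module I)"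
  obtains f g where "from_interval M I f" "to_interval s M I g"
    "\<And>x v. x \<in> I \<Longrightarrow> v \<in> obj M x \<Longrightarrow> v = s (g x v) (f x)"
    "\<And>x. x \<in> I \<Longrightarrow> g x (f x) = (1 :: 'k)"
proof -
  interpret pmodule s M by fact
  obtain \<phi> where lin: "\<And>x. lin_map_on s (*) (obj M x) (obj (interval_module I) x) (\<phi> x)"
    and bij: "\<And>x. bij_betw (\<phi> x) (obj M x) (obj (interval_module I) x)"
    and nat: "\<And>x y v. x \<le> y \<Longrightarrow> v \<in> obj M x \<Longrightarrow>
      \<phi> y (mor M y x v) = mor (interval_module I :: (_, 'k) pmod) y x (\<phi> x v)"
    using iso unfolding pmod_iso_def by metis
  define f where "f = (\<lambda>x. inv_into (obj M x) (\<phi> x) 1)"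
  have bijI: "bij_betw (\<phi> x) (obj M x) UNIV" if "x \<in> I" for x
    using bij[of x] that by (simp add: interval_module_def)
  have f: "f x \<in> obj M x" "\<phi> x (f x) = 1" if "x \<in> I" for x
    unfolding f_def using bijI[OF that]
    by (auto simp: bij_betw_def intro!: inv_into_into f_inv_into_f)
  have inj: "v = w" if "v \<in> obj M x" "w \<in> obj M x" "\<phi> x v = \<phi> x w" for x v w
    using bij[of x] that by (auto simp: bij_betw_def inj_on_def)
  have mor: "mor M y x v \<in> obj M y" if "x \<le> y" "v \<in> obj M x" for x y v
    using lin_map_onD(1)[OF linear_mor] that by blast
  show ?thesis
  proof
    show "to_interval s M I \<phi>"
      unfolding to_interval_def
    proof (intro conjI ballI allI impI)
      show "lin_map_on s (*) (obj M x) UNIV (\<phi> x)" for x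
        using lin[of x] by (rule lin_map_on_subset) auto
      show "\<phi> y (mor M y x v) = (if x \<in> I then \<phi> x v else 0)"
        if "x \<le> y" "y \<in> I" "v \<in> obj M x" for x y v
        using nat[OF that(1,3)] that by (auto simp: interval_module_def)
    qed
    show "from_interval M I f"
      unfolding from_interval_def
    proof (intro conjI ballI allI impI f(1))
      \<comment> \<open>Naturality of f is checked after applying the injective
        \<open>\<phi> y\<close>; for y outside I both sides go to 0.\<close>
      fix x y assume xy: "x \<in> I" "x \<le> y"
      have "\<phi> y (mor M y x (f x)) = (if y \<in> I then 1 else 0)"
        using nat[OF xy(2) f(1)[OF xy(1)]] xy f(2) by (auto simp: interval_module_def)
      moreover have "\<phi> y 0 = 0"
        using lin_map_on_zero[OF lin subspace_obj] .
      ultimately show "mor M y x (f x) = (if y \<in> I then f y else 0)"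
        using mor[OF xy(2) f(1)[OF xy(1)]] f[of y] subspace_0[OF subspace_obj, of y] inj[of _ y]
        by auto
    qed
    show "v = s (\<phi> x v) (f x)" if "x \<in> I" "v \<in> obj M x" for x v
      using that f[OF that(1)] lin_map_onD(3)[OF lin f(1)[OF that(1)], of "\<phi> x v"]
      by (intro inj[of _ x] subspace_scale[OF subspace_obj]) auto
  qed (use f in auto)
qed


section \<open>Direct sums\<close>

lemma restr_simps [simp]:
  "obj (restr M U) = U" "mor (restr M U) = mor M" "restr (restr M U) V = restr M V"
  "restr M (obj M) = M"
  by (simp_all add: restr_def)

context pmodule
begin

lemma mor_in_obj: "x \<le> y \<Longrightarrow> v \<in> obj M x \<Longrightarrow> mor M y x v \<in> obj M y"
  using lin_map_onD(1)[OF linear_mor] by blast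

lemma findim_obj: "findim (obj M x)"
  using finite_dim_obj[of x] by (auto simp: findim_def)

lemma submodD:
  assumes "submod s M U"
  shows "subspace (U x)" "v \<in> U x \<Longrightarrow> v \<in> obj M x" "x \<le> y \<Longrightarrow> v \<in> U x \<Longrightarrow> mor M y x v \<in> U y"
  using assms unfolding submod_def by blast+

lemma pmodule_restr:
  assumes U: "submod s M U"
  shows "pmodule s (restr M U)"
proof unfold_locales
  fix x y z :: 'p and v
  show "subspace (obj (restr M U) x)" using submodD(1)[OF U] by simp
  have "findim (U x)"
    using findim_subset[OF findim_obj] submodD(2)[OF U] by blast
  then obtain B where B: "B \<subseteq> U x" "finite B" "U x \<subseteq> span B"
    by (rule findim_basis)
  then have "span B = U x"
    using span_minimal[OF B(1) submodD(1)[OF U]] by blast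
  with B(2) show "\<exists>B. finite B \<and> span B = obj (restr M U) x" by auto
  show "lin_map_on s s (obj (restr M U) x) (obj (restr M U) y) (mor (restr M U) y x)" if "x \<le> y"
    using linear_mor[OF that] submodD[OF U] that by (auto simp: lin_map_on_def)
  show "mor (restr M U) x x v = v" if "v \<in> obj (restr M U) x"
    using that submodD(2)[OF U] mor_id by simp
  show "mor (restr M U) z y (mor (restr M U) y x v) = mor (restr M U) z x v"
    if "x \<le> y" "y \<le> z" "v \<in> obj (restr M U) x"
    using that submodD(2)[OF U] mor_comp by simp
qed

text \<open>Uniqueness of components reduces to independence by subtracting two decompositions of
  the same vector.\<close>

lemma direct_sumI:
  assumes sub: "\<And>j. j < n \<Longrightarrow> submod s M (U j)"
    and ex: "\<And>x v. v \<in> obj M x \<Longrightarrow> \<exists>u. (\<forall>j<n. u j \<in> U j x) \<and> v = (\<Sum>j<n. u j)"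
    and indep: "\<And>x u. (\<And>j. j < n \<Longrightarrow> u j \<in> U j x) \<Longrightarrow> (\<Sum>j<n. u j) = 0 \<Longrightarrow> \<forall>j<n. u j = 0"
  shows "direct_sum s M n U"
  unfolding direct_sum_def
proof (intro conjI allI impI ballI sub)
  fix x v assume "v \<in> obj M x"
  then obtain u where u: "\<forall>j<n. u j \<in> U j x" "v = (\<Sum>j<n. u j)"
    using ex by blast
  show "\<exists>!u. (\<forall>j<n. u j \<in> U j x) \<and> (\<forall>j\<ge>n. u j = 0) \<and> v = (\<Sum>j<n. u j)"
  proof (rule ex1I[of _ "\<lambda>j. if j < n then u j else 0"], goal_cases)
    case 1
    then show ?case using u by auto
  next
    case (2 u')
    have "\<forall>j<n. u' j - u j = 0"
    proof (rule indep)
      show "u' j - u j \<in> U j x" if "j < n" for j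
        using that 2 u(1) submodD(1)[OF sub] subspace_diff by blast
      show "(\<Sum>j<n. u' j - u j) = 0"
        using 2 u(2) by (simp add: sum_subtractf)
    qed
    with 2 show ?case by (auto simp: fun_eq_iff)
  qed
qed

lemma direct_sumD:
  assumes "direct_sum s M n U"
  shows "j < n \<Longrightarrow> submod s M (U j)"
    and "v \<in> obj M x \<Longrightarrow> \<exists>u. (\<forall>j<n. u j \<in> U j x) \<and> v = (\<Sum>j<n. u j)"
    and "(\<And>j. j < n \<Longrightarrow> u j \<in> U j x) \<Longrightarrow> (\<And>j. j < n \<Longrightarrow> u' j \<in> U j x) \<Longrightarrow>
      (\<Sum>j<n. u j) = (\<Sum>j<n. u' j) \<Longrightarrow> j < n \<Longrightarrow> u j = u' j"
proof -
  show sub: "j < n \<Longrightarrow> submod s M (U j)" for j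
    using assms by (auto simp: direct_sum_def)
  show "v \<in> obj M x \<Longrightarrow> \<exists>u. (\<forall>j<n. u j \<in> U j x) \<and> v = (\<Sum>j<n. u j)"
    using assms unfolding direct_sum_def by blast
  assume u: "\<And>j. j < n \<Longrightarrow> u j \<in> U j x" and u': "\<And>j. j < n \<Longrightarrow> u' j \<in> U j x"
    and eq: "(\<Sum>j<n. u j) = (\<Sum>j<n. u' j)" and j: "j < n"
  \<comment> \<open>Uniqueness in \<open>direct_sum\<close> speaks only of families that vanish from
    n on, so arbitrary families are truncated before they are compared.\<close>
  define cut where "cut = (\<lambda>u j. if j < n then u j else (0::'v))"
  let ?P = "\<lambda>v w. (\<forall>j<n. w j \<in> U j x) \<and> (\<forall>j\<ge>n. w j = 0) \<and> v = (\<Sum>j<n. w j)"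
  have "(\<Sum>j<n. u j) \<in> obj M x"
    using u submodD(2)[OF sub] by (intro subspace_sum subspace_obj) auto
  then have "\<exists>!w. ?P (\<Sum>j<n. u j) w"
    using assms unfolding direct_sum_def by blast
  moreover have "?P (\<Sum>j<n. u j) (cut u)" "?P (\<Sum>j<n. u j) (cut u')"
    using u u' eq by (auto simp: cut_def)
  ultimately have "cut u = cut u'" by blast
  then show "u j = u' j"
    using j by (auto simp: cut_def fun_eq_iff split: if_splits)
qed

text \<open>All properties come from uniqueness of components: to identify \<open>p j x v\<close> it
  suffices to exhibit a family in the summands with sum v. For naturality this family is the image
  of the components, which stays in the summands as they are submodules.\<close>

lemma direct_sum_projections:
  assumes D: "direct_sum s M n U"
  obtains p where
    "\<And>j x. j < n \<Longrightarrow> lin_map_on s s (obj M x) (U j x) (p j x)"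
    "\<And>x v. v \<in> obj M x \<Longrightarrow> v = (\<Sum>j<n. p j x v)"
    "\<And>j x y v. j < n \<Longrightarrow> x \<le> y \<Longrightarrow> v \<in> obj M x \<Longrightarrow> p j y (mor M y x v) = mor M y x (p j x v)"
    "\<And>i j x v. i < n \<Longrightarrow> j < n \<Longrightarrow> v \<in> U j x \<Longrightarrow> p i x v = (if i = j then v else 0)"
proof -
  note sub = direct_sumD(1)[OF D]
  have "\<forall>x. \<forall>v\<in>obj M x. \<exists>u. (\<forall>j<n. u j \<in> U j x) \<and> v = (\<Sum>j<n. u j)"
    using direct_sumD(2)[OF D] by blast
  then obtain u where u: "\<And>x v. v \<in> obj M x \<Longrightarrow> (\<forall>j<n. u x v j \<in> U j x) \<and> v = (\<Sum>j<n. u x v j)"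
    by metis
  define p where "p = (\<lambda>j x v. u x v j)"
  have pU: "p j x v \<in> U j x" if "v \<in> obj M x" "j < n" for j x v
    using u[OF that(1)] that(2) by (auto simp: p_def)
  have psum: "v = (\<Sum>j<n. p j x v)" if "v \<in> obj M x" for x v
    using u[OF that] by (auto simp: p_def)
  have uniq: "p j x v = w j"
    if "v \<in> obj M x" "\<And>j. j < n \<Longrightarrow> w j \<in> U j x" "v = (\<Sum>j<n. w j)" "j < n" for j x v w
    using that pU[OF that(1)] psum[OF that(1)]
    by (intro direct_sumD(3)[OF D, of "\<lambda>j. p j x v" x w j]) auto
  show ?thesis
  proof
    show "lin_map_on s s (obj M x) (U j x) (p j x)" if j: "j < n" for j x
      unfolding lin_map_on_def
    proof (intro conjI ballI allI)
      fix v v' k assume v: "v \<in> obj M x"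
      show "p j x v \<in> U j x" using pU[OF v j] .
      show "p j x (s k v) = s k (p j x v)"
        using psum[OF v] pU[OF v] v j sub subspace_scale[OF subspace_obj]
        by (intro uniq[where w = "\<lambda>j. s k (p j x v)"])
          (auto simp: scale_sum_right[symmetric] intro!: subspace_scale submodD(1))
      assume v': "v' \<in> obj M x"
      show "p j x (v + v') = p j x v + p j x v'"
        using psum[OF v] psum[OF v'] pU[OF v] pU[OF v'] v v' j sub subspace_add[OF subspace_obj]
        by (intro uniq[where w = "\<lambda>j. p j x v + p j x v'"])
          (auto simp: sum.distrib intro!: subspace_add submodD(1))
    qed
    show "p j y (mor M y x v) = mor M y x (p j x v)"
      if "j < n" "x \<le> y" "v \<in> obj M x" for j x y v
    proof (rule uniq[where w = "\<lambda>j. mor M y x (p j x v)"])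
      have "mor M y x (\<Sum>j<n. p j x v) = (\<Sum>j<n. mor M y x (p j x v))"
        using pU[OF that(3)] sub
        by (intro lin_map_on_sum[OF linear_mor[OF that(2)] subspace_obj]) (auto dest: submodD(2))
      then show "mor M y x v = (\<Sum>j<n. mor M y x (p j x v))"
        using psum[OF that(3)] by simp
    qed (use that pU[OF that(3)] sub mor_in_obj submodD(3) in auto)
    show "p i x v = (if i = j then v else 0)" if "i < n" "j < n" "v \<in> U j x" for i j x v
    proof (rule uniq[where w = "\<lambda>i. if i = j then v else 0"])
      show "(if i = j then v else 0) \<in> U i x" if "i < n" for i
        using that \<open>v \<in> U j x\<close> subspace_0[OF submodD(1)[OF sub]] by auto
      show "v \<in> obj M x"
        using submodD(2)[OF sub] that by blast
    qed (use that in auto)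
  qed (use psum in auto)
qed

lemma direct_sum_2I:
  assumes "submod s M A" "submod s M B"
    and ex: "\<And>x v. v \<in> obj M x \<Longrightarrow> \<exists>a\<in>A x. \<exists>b\<in>B x. v = a + b"
    and indep: "\<And>x v. v \<in> A x \<Longrightarrow> v \<in> B x \<Longrightarrow> v = 0"
  shows "direct_sum s M 2 (\<lambda>j. if j = 0 then A else B)"
proof (rule direct_sumI)
  have sum2: "(\<Sum>j<2::nat. u j) = u 0 + u 1" for u :: "nat \<Rightarrow> 'v"
    by (simp add: numeral_2_eq_2)
  show "\<exists>u. (\<forall>j<2::nat. u j \<in> (if j = 0 then A else B) x) \<and> v = (\<Sum>j<2::nat. u j)"
    if v: "v \<in> obj M x" for x v
  proof -
    obtain a b where "a \<in> A x" "b \<in> B x" "v = a + b"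
      using ex[OF v] by blast
    then show ?thesis
      by (intro exI[of _ "\<lambda>j::nat. if j = 0 then a else b"]) (auto simp: sum2)
  qed
  show "\<forall>j<2::nat. u j = 0"
    if u: "\<And>j::nat. j < 2 \<Longrightarrow> u j \<in> (if j = 0 then A else B) x" "(\<Sum>j<2::nat. u j) = 0" for u x
  proof -
    have "u 0 \<in> A x" "u 1 \<in> B x" "u 1 = - u 0"
      using u(1)[of 0] u(1)[of 1] u(2) by (auto simp: sum2 eq_neg_iff_add_eq_0 add.commute)
    moreover from this have "u 1 \<in> A x"
      using subspace_neg[OF submodD(1)[OF assms(1)]] by simp
    ultimately have "u 1 = 0" "u 0 = 0"
      using indep[of "u 1" x] by simp_all
    then show ?thesis by (auto simp: less_2_cases_iff)
  qed
qed (use assms in auto)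

lemma direct_sum_append:
  assumes W: "direct_sum s M 2 W" and U: "direct_sum s (restr M (W 0)) m U"
    and V: "direct_sum s (restr M (W 1)) n V"
  shows "direct_sum s M (m + n) (\<lambda>j. if j < m then U j else V (j - m))" (is "direct_sum s M _ ?X")
proof -
  interpret W0: pmodule s "restr M (W 0)"
    using pmodule_restr direct_sumD(1)[OF W] by simp
  interpret W1: pmodule s "restr M (W 1)"
    using pmodule_restr direct_sumD(1)[OF W] by simp
  have sum2: "(\<Sum>j<2. u j) = u 0 + u 1" for u :: "nat \<Rightarrow> 'v"
    by (simp add: numeral_2_eq_2)
  have sum_mn: "(\<Sum>j<m + n. u j) = (\<Sum>j<m. u j) + (\<Sum>j<n. u (m + j))" for u :: "nat \<Rightarrow> 'v"
    by (induction n) (auto simp: add.assoc)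
  have subU: "submod s M (U j)" if "j < m" for j
    using W0.direct_sumD(1)[OF U that] direct_sumD(1)[OF W, of 0] by (fastforce simp: submod_def)
  have subV: "submod s M (V j)" if "j < n" for j
    using W1.direct_sumD(1)[OF V that] direct_sumD(1)[OF W, of 1] by (fastforce simp: submod_def)
  show ?thesis
  proof (rule direct_sumI)
    show "submod s M (?X j)" if "j < m + n" for j
      using subU subV that by auto
    show "\<exists>u. (\<forall>j<m + n. u j \<in> ?X j x) \<and> v = (\<Sum>j<m + n. u j)" if v: "v \<in> obj M x" for x v
    proof -
      obtain w where w: "\<forall>j<2. w j \<in> W j x" "v = (\<Sum>j<2. w j)"
        using direct_sumD(2)[OF W v] by blast
      obtain u0 where u0: "\<forall>j<m. u0 j \<in> U j x" "w 0 = (\<Sum>j<m. u0 j)"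
        using W0.direct_sumD(2)[OF U, of "w 0" x] w(1) by auto
      obtain u1 where u1: "\<forall>j<n. u1 j \<in> V j x" "w 1 = (\<Sum>j<n. u1 j)"
        using W1.direct_sumD(2)[OF V, of "w 1" x] w(1) by auto
      show ?thesis
        using w(2) u0 u1
        by (intro exI[of _ "\<lambda>j. if j < m then u0 j else u1 (j - m)"]) (auto simp: sum2 sum_mn)
    qed
    show "\<forall>j<m + n. u j = 0"
      if u: "\<And>j. j < m + n \<Longrightarrow> u j \<in> ?X j x" "(\<Sum>j<m + n. u j) = 0" for x u
    proof -
      \<comment> \<open>Grouping a vanishing sum along W gives two partial sums that vanish
        separately; then U and V each give the vanishing of their own terms.\<close>
      define w where "w = (\<lambda>j::nat. if j = 0 then (\<Sum>j<m. u j) else (\<Sum>j<n. u (m + j)))"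
      have uU: "u j \<in> U j x" if "j < m" for j using u(1)[of j] that by simp
      have uV: "u (m + j) \<in> V j x" if "j < n" for j using u(1)[of "m + j"] that by simp
      have "w 0 \<in> W 0 x"
        using uU W0.submodD(2)[OF W0.direct_sumD(1)[OF U]] direct_sumD(1)[OF W, of 0]
        by (auto simp: w_def intro!: subspace_sum submodD(1))
      moreover have "w 1 \<in> W 1 x"
        using uV W1.submodD(2)[OF W1.direct_sumD(1)[OF V]] direct_sumD(1)[OF W, of 1]
        by (auto simp: w_def intro!: subspace_sum submodD(1))
      moreover have "(\<Sum>j<2. w j) = (\<Sum>j<2. 0)"
        using u(2) by (simp add: sum2 sum_mn w_def)
      ultimately have w0: "w j = 0" if "j < 2" for j
        using that direct_sumD(1)[OF W]
        by (intro direct_sumD(3)[OF W, of w x "\<lambda>_. 0"])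
          (auto simp: less_2_cases_iff intro!: subspace_0 submodD(1))
      have "u j = 0" if "j < m" for j
        using that w0[of 0] uU subU
        by (intro W0.direct_sumD(3)[OF U, of u x "\<lambda>_. 0"])
          (auto simp: w_def intro!: subspace_0 submodD(1))
      moreover have "u (m + j) = 0" if "j < n" for j
        using that w0[of 1] uV subV
        by (intro W1.direct_sumD(3)[OF V, of "\<lambda>j. u (m + j)" x "\<lambda>_. 0"])
          (auto simp: w_def intro!: subspace_0 submodD(1))
      ultimately show ?thesis
        by (metis add_diff_inverse_nat nat_add_left_cancel_less)
    qed
  qed
qed

text \<open>If g o f is a nonzero scalar k, then (f o g) / k is an idempotent endomorphism of M, so
  M is the direct sum of the image of f and the kernel of g. Indecomposability and f being nonzero
  force the kernel to be 0, and g becomes the isomorphism.\<close>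

lemma indecomposable_iso_interval_module:
  assumes I: "interval I" and ind: "indecomposable s M"
    and f: "from_interval M I f" and g: "to_interval s M I g"
    and x0: "x0 \<in> I" "g x0 (f x0) \<noteq> 0"
  shows "pmod_iso s M (*) (interval_module I)"
proof -
  define k where "k = g x0 (f x0)"
  have k: "g x (f x) = k" if "x \<in> I" for x
    using pairing_constant[OF I f g that x0(1)] by (simp add: k_def)
  have k0: "k \<noteq> 0" using x0(2) by (simp add: k_def)
  note fD = from_intervalD[OF f] and gD = to_intervalD[OF g]
  define A where "A = (\<lambda>x. if x \<in> I then range (\<lambda>c. s c (f x)) else {0})"
  \<comment> \<open>Outside I the target of g is 0, so the kernel there is all of
    \<open>obj M x\<close>.\<close>
  define B where "B = (\<lambda>x. if x \<in> I then {v \<in> obj M x. g x v = 0} else obj M x)"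
  have g0: "g x 0 = 0" if "x \<in> I" for x
    using lin_map_on_zero[OF gD(1)[OF that] subspace_obj] .
  have mor0: "mor M y x 0 = 0" if "x \<le> y" for x y
    using lin_map_on_zero[OF linear_mor[OF that] subspace_obj] .
  have A: "submod s M A"
    unfolding submod_def
  proof (intro conjI allI impI)
    show "subspace (A x)" for x
      by (auto simp: A_def span_singleton[symmetric])
    show "A x \<subseteq> obj M x" for x
      using fD(1) subspace_scale[OF subspace_obj] subspace_0[OF subspace_obj] by (auto simp: A_def)
    show "mor M y x ` A x \<subseteq> A y" if "x \<le> y" for x y
    proof (cases "x \<in> I")
      case True
      have "mor M y x (s c (f x)) = s c (if y \<in> I then f y else 0)" for c
        using lin_map_onD(3)[OF linear_mor[OF that] fD(1)[OF True]] fD(2)[OF True that] by simp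
      with True show ?thesis by (auto simp: A_def)
    next
      case False
      have "0 \<in> A y" unfolding A_def by (auto intro: range_eqI[of _ _ 0])
      with False mor0[OF that] show ?thesis by (simp add: A_def)
    qed
  qed
  have B: "submod s M B"
    unfolding submod_def
  proof (intro conjI allI impI)
    show "subspace (B x)" for x
      using lin_map_on_kernel[OF gD(1) subspace_obj vector_space_mult] subspace_obj
      by (auto simp: B_def)
    show "B x \<subseteq> obj M x" for x by (auto simp: B_def)
    show "mor M y x ` B x \<subseteq> B y" if "x \<le> y" for x y
      using that gD(2)[of y x] mor_in_obj by (auto simp: B_def)
  qed
  have "direct_sum s M 2 (\<lambda>j. if j = 0 then A else B)"
  proof (rule direct_sum_2I[OF A B])
    show "\<exists>a\<in>A x. \<exists>b\<in>B x. v = a + b" if v: "v \<in> obj M x" for x v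
    proof (cases "x \<in> I")
      case True
      \<comment> \<open>The value at v of the idempotent (f o g) / k; subtracting it from v lands in
        the kernel of g.\<close>
      let ?a = "s (g x v / k) (f x)"
      have "?a \<in> obj M x" using fD(1)[OF True] subspace_scale[OF subspace_obj] by blast
      moreover from this have "g x (v - ?a) = 0"
        using lin_map_on_diff[OF gD(1)[OF True] subspace_obj v] k[OF True] k0
          lin_map_onD(3)[OF gD(1)[OF True] fD(1)[OF True]] by simp
      ultimately have "v - ?a \<in> B x"
        using True v subspace_diff[OF subspace_obj] by (auto simp: B_def)
      moreover have "?a \<in> A x" using True by (auto simp: A_def)
      ultimately show ?thesis
        by (intro bexI[of _ ?a] bexI[of _ "v - ?a"]) auto
    next
      case False
      then show ?thesis using v by (auto simp: A_def B_def)
    qed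
    show "v = 0" if "v \<in> A x" "v \<in> B x" for x v
    proof (cases "x \<in> I")
      case True
      then obtain c where "v = s c (f x)" "g x v = 0"
        using \<open>v \<in> A x\<close> \<open>v \<in> B x\<close> by (auto simp: A_def B_def)
      then show ?thesis
        using lin_map_onD(3)[OF gD(1)[OF True] fD(1)[OF True], of c] k[OF True] k0 by auto
    qed (use that in \<open>auto simp: A_def\<close>)
  qed
  then obtain j :: nat where "\<forall>x. (if j = 0 then A else B) x = {0}"
    using ind unfolding indecomposable_def by blast
  moreover have "A x0 \<noteq> {0}"
  proof -
    have "f x0 \<in> A x0" using x0(1) by (auto simp: A_def intro: range_eqI[of _ _ 1])
    moreover have "f x0 \<noteq> 0" using g0[OF x0(1)] x0(2) by auto
    ultimately show ?thesis by auto
  qed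
  ultimately have B0: "B x = {0}" for x
    by (auto split: if_splits)
  \<comment> \<open>Values of g outside I are unspecified, hence the reset to 0.\<close>
  define \<phi> where "\<phi> = (\<lambda>x v. if x \<in> I then g x v else 0)"
  show ?thesis
    unfolding pmod_iso_def
  proof (intro exI[of _ \<phi>] conjI allI impI ballI)
    fix x
    show "lin_map_on s (*) (obj M x) (obj (interval_module I) x) (\<phi> x)"
      using gD(1)[of x] by (auto simp: \<phi>_def interval_module_def lin_map_on_def)
    show "bij_betw (\<phi> x) (obj M x) (obj (interval_module I) x)"
    proof (cases "x \<in> I")
      case True
      have "inj_on (g x) (obj M x)"
      proof
        fix v w assume vw: "v \<in> obj M x" "w \<in> obj M x" "g x v = g x w"
        then have "v - w \<in> B x"
          using True lin_map_on_diff[OF gD(1)[OF True] subspace_obj] subspace_diff[OF subspace_obj]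
          by (auto simp: B_def)
        with B0 show "v = w" by auto
      qed
      moreover have "c \<in> g x ` obj M x" for c
      proof
        show "c = g x (s (c / k) (f x))"
          using lin_map_onD(3)[OF gD(1)[OF True] fD(1)[OF True]] k[OF True] k0 by simp
        show "s (c / k) (f x) \<in> obj M x"
          using fD(1)[OF True] subspace_scale[OF subspace_obj] by blast
      qed
      ultimately show ?thesis
        using True by (auto simp: bij_betw_def \<phi>_def interval_module_def)
    next
      case False
      then have "obj M x = {0}" using B0[of x] by (simp add: B_def)
      then show ?thesis using False by (auto simp: bij_betw_def \<phi>_def interval_module_def)
    qed
    show "\<phi> y (mor M y x v) = mor (interval_module I) y x (\<phi> x v)"
      if "x \<le> y" "v \<in> obj M x" for y v
      using that gD(2)[of y x v] by (auto simp: \<phi>_def interval_module_def)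
  qed
qed

end

text \<open>Induction on the total dimension. A nonzero module that is not indecomposable splits
  into two nonzero summands, and each is strictly smaller since it misses the nonzero vectors of the
  other. The zero module, which is not indecomposable, gets the empty decomposition.\<close>

lemma indec_decomposition_exists:
  assumes "pmodule s M"
  shows "\<exists>n U. indec_decomposition s M n U"
  using assms
proof (induction "\<Sum>x\<in>UNIV. vector_space.dim s (obj M x)" arbitrary: M rule: less_induct)
  case less
  interpret pmodule s M by (rule less.prems)
  show ?case
  proof (cases "indecomposable s M")
    case True
    have "direct_sum s M 1 (\<lambda>_. obj M)"
    proof (rule direct_sumI)
      show "submod s M (obj M)"
        using subspace_obj mor_in_obj by (auto simp: submod_def)
      show "\<exists>u. (\<forall>j<1. u j \<in> obj M x) \<and> v = (\<Sum>j<1::nat. u j)" if "v \<in> obj M x" for x v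
        using that by (intro exI[of _ "\<lambda>_. v"]) auto
    qed auto
    with True show ?thesis
      unfolding indec_decomposition_def by (intro exI[of _ 1] exI[of _ "\<lambda>_. obj M"]) simp
  next
    case False
    show ?thesis
    proof (cases "\<forall>x. obj M x = {0}")
      case True
      have "direct_sum s M 0 U" for U
        by (rule direct_sumI) (use True in auto)
      then show ?thesis
        unfolding indec_decomposition_def by (intro exI[of _ 0]) auto
    next
      case nonzero: False
      then obtain W where W: "direct_sum s M 2 W" and W0: "\<And>j. j < 2 \<Longrightarrow> \<exists>x. W j x \<noteq> {0}"
        using False unfolding indecomposable_def by metis
      have smaller: "(\<Sum>x\<in>UNIV. dim (W i x)) < (\<Sum>x\<in>UNIV. dim (obj M x))"
        if ij: "i < 2" "j < 2" "i \<noteq> j" for i j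
      proof (rule sum_strict_mono_ex1)
        have sub: "submod s M (W i)" "submod s M (W j)"
          using direct_sumD(1)[OF W] ij by auto
        have "W i x \<subseteq> obj M x" for x
          using submodD(2)[OF sub(1)] by blast
        note * = dim_psubset_subspace[OF submodD(1)[OF sub(1)] this findim_obj]
        show "\<forall>x\<in>UNIV. dim (W i x) \<le> dim (obj M x)" using *(1) by blast
        obtain x v where v: "v \<in> W j x" "v \<noteq> 0"
          using W0[OF ij(2)] subspace_0[OF submodD(1)[OF sub(2)]] by blast
        have "v \<notin> W i x"
        proof
          assume vi: "v \<in> W i x"
          \<comment> \<open>Otherwise v would have two decompositions along W: all of it in
            component i, or all of it in component j.\<close>
          have "(if i = i then v else 0) = (if i = j then v else 0)"
            using ij v(1) vi subspace_0[OF submodD(1)[OF direct_sumD(1)[OF W]]]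
            by (intro direct_sumD(3)[OF W, of "\<lambda>l. if l = i then v else 0" x
                  "\<lambda>l. if l = j then v else 0"]) auto
          with ij v(2) show False by simp
        qed
        then have "obj M x \<noteq> W i x"
          using submodD(2)[OF sub(2) v(1)] by blast
        then show "\<exists>x\<in>UNIV. dim (W i x) < dim (obj M x)" using *(2) by blast
      qed simp
      have "\<exists>n U. indec_decomposition s (restr M (W 0)) n U"
        using smaller[of 0 1] pmodule_restr direct_sumD(1)[OF W] by (intro less.hyps) auto
      then obtain m U where U: "indec_decomposition s (restr M (W 0)) m U" by blast
      have "\<exists>n U. indec_decomposition s (restr M (W 1)) n U"
        using smaller[of 1 0] pmodule_restr direct_sumD(1)[OF W] by (intro less.hyps) auto
      then obtain n V where V: "indec_decomposition s (restr M (W 1)) n V" by blast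
      have "indec_decomposition s M (m + n) (\<lambda>j. if j < m then U j else V (j - m))"
        using direct_sum_append[OF W] U V by (auto simp: indec_decomposition_def)
      then show ?thesis by blast
    qed
  qed
qed


section \<open>The kernel of the upper blocks and the cokernel of the lower blocks\<close>

lemma ex_sc_le:
  fixes x :: "'p::{order,finite}"
  assumes "x \<in> U"
  shows "\<exists>a\<in>sc U. a \<le> x"
  using finite_has_minimal2[of U x] assms by (auto simp: sc_def)

lemma ex_sk_ge:
  fixes x :: "'p::{order,finite}"
  assumes "x \<in> U"
  shows "\<exists>b\<in>sk U. x \<le> b"
  using finite_has_maximal2[of U x] assms by (auto simp: sk_def)

lemma lo_hi_pair:
  assumes r: "linear_order_on S r" and A: "A \<subseteq> S" "card A = 2"
  shows "A = {lo r A, hi r A}" "lo r A \<noteq> hi r A"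
proof -
  obtain x y where xy: "A = {x, y}" "x \<noteq> y"
    using A(2) by (auto simp: card_2_iff)
  then obtain a b where ab: "A = {a, b}" "a \<noteq> b" "(a, b) \<in> r"
    using r A(1) unfolding linear_order_on_def total_on_def by (metis insert_commute insert_subset)
  have "(b, a) \<notin> r"
    using r ab unfolding linear_order_on_def partial_order_on_def antisym_def by blast
  moreover have "(a, a) \<in> r" "(b, b) \<in> r"
    using r ab(1) A(1) unfolding linear_order_on_def partial_order_on_def preorder_on_def refl_on_def
    by blast+
  ultimately have "lo r A = a" "hi r A = b"
    unfolding lo_def hi_def using ab by (auto intro!: the_equality)
  with ab show "A = {lo r A, hi r A}" "lo r A \<noteq> hi r A" by auto
qed

lemma sum_two_support:
  assumes "finite S" "a \<in> S" "b \<in> S" "a \<noteq> b" "\<And>x. x \<in> S \<Longrightarrow> x \<noteq> a \<Longrightarrow> x \<noteq> b \<Longrightarrow> h x = 0"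
  shows "sum h S = h a + (h b :: 'v::comm_monoid_add)"
proof -
  have "sum h S = sum h {a, b}"
    using assms by (intro sum.mono_neutral_right) auto
  with assms(4) show ?thesis by simp
qed

lemma sum_blk_sets:
  assumes "finite X" "finite Y" "finite Z"
  shows "(\<Sum>c\<in>blk_sets X Y Z. h c) =
    (\<Sum>x\<in>X. h (B1 x)) + (\<Sum>y\<in>Y. h (B2 y)) + (\<Sum>z\<in>Z. h (B3 z))"
proof -
  have "inj_on B1 X" "inj_on B2 Y" "inj_on B3 Z" by (auto simp: inj_on_def)
  then show ?thesis
    unfolding blk_sets_def using assms
    by (subst sum.union_disjoint sum.reindex; auto simp: sum.reindex)+
qed

lemma blk_sets_simps [simp]:
  "B1 x \<in> blk_sets X Y Z \<longleftrightarrow> x \<in> X"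
  "B2 y \<in> blk_sets X Y Z \<longleftrightarrow> y \<in> Y"
  "B3 z \<in> blk_sets X Y Z \<longleftrightarrow> z \<in> Z"
  by (auto simp: blk_sets_def)

lemma (in vector_space) lin_map_on_const_0: "subspace W \<Longrightarrow> lin_map_on scale scale V W (\<lambda>v. 0)"
  by (simp add: lin_map_on_def subspace_0)

lemma (in vector_space) lin_map_on_uminus:
  "lin_map_on scale scale V W f \<Longrightarrow> subspace W \<Longrightarrow> lin_map_on scale scale V W (\<lambda>v. - f v)"
  by (simp add: lin_map_on_def subspace_neg)

locale interval_matrices = pmodule s M
  for s :: "'k::field \<Rightarrow> 'v::ab_group_add \<Rightarrow> 'v" and M :: "('p::{order,finite}, 'v) pmod" +
  fixes I :: "'p set" and r q :: "'p rel" and cm dm :: "'p \<Rightarrow> 'p" and a0 b0 :: 'p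
  assumes I: "interval I"
    and r: "linear_order_on (sc I) r"
    and q: "linear_order_on (sk I) q"
    and cm: "a' \<in> sc (Up I) \<Longrightarrow> cm a' \<in> sc I \<and> cm a' \<le> a'"
    and dm: "b' \<in> sk (Down I) \<Longrightarrow> dm b' \<in> sk I \<and> dm b' \<ge> b'"
    and b0: "b0 \<in> sk I" and a0: "a0 \<in> sc I" and a0_le_b0: "b0 \<ge> a0"
begin

abbreviation "rows \<equiv> row_idx r I"
abbreviation "cols \<equiv> col_idx q I"

definition row_tgt :: "('p set \<times> 'p, 'p, 'p) blk \<Rightarrow> 'v set" where
  "row_tgt = blk_row (\<lambda>(A, c). obj M c) (obj M) (obj M)"

text \<open>Entries outside \<open>cols\<close> are unconstrained, exactly as in
  \<open>mat_rank\<close>, while \<open>targets\<close> forces 0 outside \<open>rows\<close>, as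
  \<open>mat_apply\<close> does. Finite dimension is therefore claimed only on the target
  side.\<close>

definition "sources = {u. \<forall>c\<in>cols. u c \<in> col_src M c}"
definition "targets = {w. (\<forall>i\<in>rows. w i \<in> row_tgt i) \<and> (\<forall>i. i \<notin> rows \<longrightarrow> w i = 0)}"

text \<open>The lower left block is a parameter: \<open>matM3 M b0 a0\<close> and
  \<open>zero_block\<close> give the two matrices of the theorem.\<close>

definition mat_map :: "('p \<Rightarrow> 'p \<Rightarrow> 'v \<Rightarrow> 'v) \<Rightarrow> (('p, 'p, 'p set \<times> 'p) blk \<Rightarrow> 'v)
    \<Rightarrow> ('p set \<times> 'p, 'p, 'p) blk \<Rightarrow> 'v" where
  "mat_map N = mat_apply rows cols
     (block_matrix
        (matM1 M r)   zero_block    zero_block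
        (matM2 M cm)  zero_block    zero_block
        N             (matM4 M dm)  (matM5 M q))"

text \<open>The share of a bottom row coming from the second and third block columns; it is common
  to both matrices.\<close>

definition "low_row u b =
  (\<Sum>b'\<in>sk (Down I). matM4 M dm b b' (u (B2 b'))) + (\<Sum>p\<in>sk1 q I. matM5 M q b p (u (B3 p)))"

section \<open>Entries and rows of the two matrices\<close>

lemma sc_subset: "sc U \<subseteq> U" and sk_subset: "sk U \<subseteq> U"
  by (auto simp: sc_def sk_def)

lemma sc1D:
  assumes "(A, c) \<in> sc1 r I"
  shows "A = {lo r A, hi r A}" "lo r A \<noteq> hi r A" "lo r A \<in> sc I" "hi r A \<in> sc I"
    "lo r A \<le> c" "hi r A \<le> c"
proof -
  have A: "A \<subseteq> sc I" "card A = 2" "c \<in> vee r A"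
    using assms by (auto simp: sc1_def)
  note p = lo_hi_pair[OF r A(1,2)]
  show "A = {lo r A, hi r A}" "lo r A \<noteq> hi r A" by (rule p)+
  have "lo r A \<in> A" "hi r A \<in> A"
    using p(1) by (metis insertI1, metis insertCI)
  then show "lo r A \<in> sc I" "hi r A \<in> sc I" using A(1) by blast+
  show "lo r A \<le> c" "hi r A \<le> c" using A(3) by (auto simp: vee_def sc_def)
qed

lemma sk1D:
  assumes "(B, d) \<in> sk1 q I"
  shows "B = {lo q B, hi q B}" "lo q B \<noteq> hi q B" "lo q B \<in> sk I" "hi q B \<in> sk I"
    "d \<le> lo q B" "d \<le> hi q B"
proof -
  have B: "B \<subseteq> sk I" "card B = 2" "d \<in> wedge q B"
    using assms by (auto simp: sk1_def)
  note p = lo_hi_pair[OF q B(1,2)]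
  show "B = {lo q B, hi q B}" "lo q B \<noteq> hi q B" by (rule p)+
  have "lo q B \<in> B" "hi q B \<in> B"
    using p(1) by (metis insertI1, metis insertCI)
  then show "lo q B \<in> sk I" "hi q B \<in> sk I" using B(1) by blast+
  show "d \<le> lo q B" "d \<le> hi q B" using B(3) by (auto simp: wedge_def sk_def)
qed

lemma matM1_simps:
  assumes "(A, c) \<in> sc1 r I"
  shows "matM1 M r (A, c) (lo r A) = mor M c (lo r A)"
    "matM1 M r (A, c) (hi r A) = (\<lambda>v. - mor M c (hi r A) v)"
    "a \<noteq> lo r A \<Longrightarrow> a \<noteq> hi r A \<Longrightarrow> matM1 M r (A, c) a = (\<lambda>v. 0)"
proof -
  have "lo r A \<in> A" "hi r A \<in> A"
    using sc1D(1)[OF assms] by (metis insertI1, metis insertCI)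
  then show "matM1 M r (A, c) (lo r A) = mor M c (lo r A)"
    "matM1 M r (A, c) (hi r A) = (\<lambda>v. - mor M c (hi r A) v)"
    using sc1D(2)[OF assms] by (auto simp: matM1_def)
  show "a \<noteq> lo r A \<Longrightarrow> a \<noteq> hi r A \<Longrightarrow> matM1 M r (A, c) a = (\<lambda>v. 0)"
    by (auto simp: matM1_def)
qed

lemma matM5_simps:
  assumes "(B, d) \<in> sk1 q I"
  shows "matM5 M q (lo q B) (B, d) = mor M (lo q B) d"
    "matM5 M q (hi q B) (B, d) = (\<lambda>v. - mor M (hi q B) d v)"
    "b \<noteq> lo q B \<Longrightarrow> b \<noteq> hi q B \<Longrightarrow> matM5 M q b (B, d) = (\<lambda>v. 0)"
proof -
  have "lo q B \<in> B" "hi q B \<in> B"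
    using sk1D(1)[OF assms] by (metis insertI1, metis insertCI)
  then show "matM5 M q (lo q B) (B, d) = mor M (lo q B) d"
    "matM5 M q (hi q B) (B, d) = (\<lambda>v. - mor M (hi q B) d v)"
    using sk1D(2)[OF assms] by (auto simp: matM5_def)
  show "b \<noteq> lo q B \<Longrightarrow> b \<noteq> hi q B \<Longrightarrow> matM5 M q b (B, d) = (\<lambda>v. 0)"
    by (auto simp: matM5_def)
qed

lemma lin_matM1:
  assumes "p \<in> sc1 r I"
  shows "lin_map_on s s (obj M a) (obj M (snd p)) (matM1 M r p a)"
proof -
  obtain A c where p: "p = (A, c)" by (cases p)
  with assms have Ac: "(A, c) \<in> sc1 r I" by simp
  consider "a = lo r A" | "a = hi r A" | "a \<noteq> lo r A" "a \<noteq> hi r A" by blast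
  then show ?thesis
    using sc1D[OF Ac] matM1_simps[OF Ac] p
    by cases (auto intro!: linear_mor lin_map_on_uminus lin_map_on_const_0 subspace_obj)
qed

lemma lin_matM5:
  assumes "p \<in> sk1 q I"
  shows "lin_map_on s s (obj M (snd p)) (obj M b) (matM5 M q b p)"
proof -
  obtain B d where p: "p = (B, d)" by (cases p)
  with assms have Bd: "(B, d) \<in> sk1 q I" by simp
  consider "b = lo q B" | "b = hi q B" | "b \<noteq> lo q B" "b \<noteq> hi q B" by blast
  then show ?thesis
    using sk1D[OF Bd] matM5_simps[OF Bd] p
    by cases (auto intro!: linear_mor lin_map_on_uminus lin_map_on_const_0 subspace_obj)
qed

lemma lin_matM2:
  "a' \<in> sc (Up I) \<Longrightarrow> lin_map_on s s (obj M a) (obj M a') (matM2 M cm a' a)"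
  using cm by (auto simp: matM2_def intro!: linear_mor lin_map_on_const_0 subspace_obj)

lemma lin_matM4:
  "b' \<in> sk (Down I) \<Longrightarrow> lin_map_on s s (obj M b') (obj M b) (matM4 M dm b b')"
  using dm by (auto simp: matM4_def intro!: linear_mor lin_map_on_const_0 subspace_obj)

lemma lin_matM3: "lin_map_on s s (obj M a) (obj M b) (matM3 M b0 a0 b a)"
  using a0_le_b0 by (auto simp: matM3_def intro!: linear_mor lin_map_on_const_0 subspace_obj)

lemma lin_zero_block: "lin_map_on s s (obj M a) (obj M b) (zero_block i j)"
  by (auto simp: zero_block_def intro!: lin_map_on_const_0 subspace_obj)

lemma subspace_row_tgt: "subspace (row_tgt i)"
  by (cases i) (auto simp: row_tgt_def blk_row_def subspace_obj)

lemma lin_mat_map: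
  assumes "\<And>a b. lin_map_on s s (obj M a) (obj M b) (N b a)"
  shows "lin_map_on (fam_scale s) (fam_scale s) sources targets (mat_map N)"
  unfolding sources_def targets_def mat_map_def
proof (rule lin_map_on_mat_apply[OF _ subspace_row_tgt])
  fix i c assume "i \<in> rows" "c \<in> cols"
  then show "lin_map_on s s (col_src M c) (row_tgt i) (block_matrix (matM1 M r) zero_block zero_block
      (matM2 M cm) zero_block zero_block N (matM4 M dm) (matM5 M q) i c)"
    using lin_matM1 lin_matM5
    by (cases i; cases c)
      (auto simp: row_tgt_def col_src_def blk_row_def block_matrix_def row_idx_def col_idx_def
        split_beta intro!: lin_zero_block lin_matM2 lin_matM4 assms)
qed

lemma mat_map_B1:
  assumes Ac: "(A, c) \<in> sc1 r I"
  shows "mat_map N u (B1 (A, c)) =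
    mor M c (lo r A) (u (B1 (lo r A))) - mor M c (hi r A) (u (B1 (hi r A)))"
proof -
  have "mat_map N u (B1 (A, c)) = (\<Sum>a\<in>sc I. matM1 M r (A, c) a (u (B1 a)))"
    using Ac by (simp add: mat_map_def mat_apply_def row_idx_def col_idx_def sum_blk_sets
        block_matrix_def blk_row_def zero_block_def)
  also have "\<dots> = matM1 M r (A, c) (lo r A) (u (B1 (lo r A)))
      + matM1 M r (A, c) (hi r A) (u (B1 (hi r A)))"
    using sc1D[OF Ac] by (intro sum_two_support) (auto simp: matM1_simps(3)[OF Ac])
  finally show ?thesis by (simp add: matM1_simps(1,2)[OF Ac])
qed

lemma mat_map_B2:
  assumes "a' \<in> sc (Up I)"
  shows "mat_map N u (B2 a') = mor M a' (cm a') (u (B1 (cm a')))"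
proof -
  have "mat_map N u (B2 a') = (\<Sum>a\<in>sc I. matM2 M cm a' a (u (B1 a)))"
    using assms by (simp add: mat_map_def mat_apply_def row_idx_def col_idx_def sum_blk_sets
        block_matrix_def blk_row_def zero_block_def)
  also have "\<dots> = (\<Sum>a\<in>sc I. if a = cm a' then mor M a' (cm a') (u (B1 (cm a'))) else 0)"
    by (intro sum.cong) (auto simp: matM2_def)
  finally show ?thesis using cm[OF assms] by simp
qed

lemma mat_map_B3:
  "b \<in> sk I \<Longrightarrow> mat_map N u (B3 b) = (\<Sum>a\<in>sc I. N b a (u (B1 a))) + low_row u b"
  by (simp add: mat_map_def mat_apply_def row_idx_def col_idx_def sum_blk_sets block_matrix_def
      blk_row_def low_row_def add.assoc)

lemma mat_map_outside: "i \<notin> rows \<Longrightarrow> mat_map N u i = 0"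
  by (simp add: mat_map_def mat_apply_def)

text \<open>In the upper rows the second and third block columns are zero and the parameter N does
  not occur, so only the first block of the family matters.\<close>

lemma mat_map_upper_cong:
  assumes "\<And>a. a \<in> sc I \<Longrightarrow> u (B1 a) = u' (B1 a)"
  shows "mat_map N u (B1 p) = mat_map N' u' (B1 p)" "mat_map N u (B2 a') = mat_map N' u' (B2 a')"
proof -
  show "mat_map N u (B1 p) = mat_map N' u' (B1 p)"
  proof (cases "p \<in> sc1 r I")
    case True
    obtain A c where p: "p = (A, c)" by (cases p)
    show ?thesis
      using sc1D(3,4)[of A c] True p by (simp add: mat_map_B1 assms)
  next
    case False
    then show ?thesis by (simp add: mat_map_outside row_idx_def)
  qed
  show "mat_map N u (B2 a') = mat_map N' u' (B2 a')"
    by (cases "a' \<in> sc (Up I)")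
      (use cm[of a'] in \<open>auto simp: mat_map_B2 assms mat_map_outside row_idx_def\<close>)
qed

text \<open>The two matrices differ in one entry, so their values differ by one vector in row
  \<open>B3 b0\<close>.\<close>

lemma mat_map_matM3:
  "mat_map (matM3 M b0 a0) u =
    mat_map zero_block u + single (B3 b0) (mor M b0 a0 (u (B1 a0)))"
proof
  fix i
  show "mat_map (matM3 M b0 a0) u i =
    (mat_map zero_block u + single (B3 b0) (mor M b0 a0 (u (B1 a0)))) i"
  proof (cases i)
    case (B3 b)
    show ?thesis
    proof (cases "b \<in> sk I")
      case True
      have "(\<Sum>a\<in>sc I. matM3 M b0 a0 b a (u (B1 a))) =
          (\<Sum>a\<in>sc I. if a = a0 then (if b = b0 then mor M b0 a0 (u (B1 a0)) else 0) else 0)"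
        by (intro sum.cong) (auto simp: matM3_def)
      then show ?thesis
        using True a0 B3 by (auto simp: mat_map_B3 zero_block_def single_def)
    next
      case False
      then show ?thesis
        using B3 b0 by (auto simp: mat_map_outside row_idx_def single_def)
    qed
  qed (auto simp: single_def intro: mat_map_upper_cong)
qed

lemma sourcesD:
  assumes "u \<in> sources"
  shows "a \<in> sc I \<Longrightarrow> u (B1 a) \<in> obj M a"
    and "b' \<in> sk (Down I) \<Longrightarrow> u (B2 b') \<in> obj M b'"
    and "p \<in> sk1 q I \<Longrightarrow> u (B3 p) \<in> obj M (snd p)"
proof -
  have *: "u c \<in> col_src M c" if "c \<in> cols" for c
    using assms that by (auto simp: sources_def)
  show "a \<in> sc I \<Longrightarrow> u (B1 a) \<in> obj M a"
    using *[of "B1 a"] by (simp add: col_idx_def col_src_def blk_row_def)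
  show "b' \<in> sk (Down I) \<Longrightarrow> u (B2 b') \<in> obj M b'"
    using *[of "B2 b'"] by (simp add: col_idx_def col_src_def blk_row_def)
  show "p \<in> sk1 q I \<Longrightarrow> u (B3 p) \<in> obj M (snd p)"
    using *[of "B3 p"] by (simp add: col_idx_def col_src_def blk_row_def split_beta)
qed

text \<open>The entries at the sources are pushed forward: the rows of M1 make the result at x
  independent of the source below x, the rows of M2 make it vanish outside I.\<close>

lemma kernel_imp_from_interval:
  assumes u: "u \<in> sources"
    and z1: "\<And>p. mat_map N u (B1 p) = 0" and z2: "\<And>a'. mat_map N u (B2 a') = 0"
  shows "\<exists>f. from_interval M I f \<and> (\<forall>a\<in>sc I. f a = u (B1 a))"
proof -
  define w where "w a = u (B1 a)" for a
  have w: "w a \<in> obj M a" if "a \<in> sc I" for a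
    using sourcesD(1)[OF u that] by (simp add: w_def)
  \<comment> \<open>A common upper bound x of two sources lies above some minimal one c, where the
    row of M1 gives equality; transport from c to x preserves it. The chosen order only affects the
    sign of that row.\<close>
  have indep: "mor M x a (w a) = mor M x a' (w a')"
    if a: "a \<in> sc I" "a' \<in> sc I" "a \<le> x" "a' \<le> x" for a a' x
  proof (cases "a = a'")
    case False
    define A where "A = {a, a'}"
    have A: "A \<subseteq> sc I" "card A = 2" using a False by (auto simp: A_def)
    note p = lo_hi_pair[OF r A]
    then have lh: "lo r A = a \<and> hi r A = a' \<or> lo r A = a' \<and> hi r A = a"
      by (auto simp: A_def doubleton_eq_iff)
    then have "x \<in> {lo r A..} \<inter> {hi r A..}" using a by auto
    then obtain c where c: "c \<in> vee r A" "c \<le> x"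
      using ex_sc_le[of x "{lo r A..} \<inter> {hi r A..}"] by (auto simp: vee_def)
    then have Ac: "(A, c) \<in> sc1 r I" using A by (auto simp: sc1_def)
    have "mor M c (lo r A) (w (lo r A)) = mor M c (hi r A) (w (hi r A))"
      using z1[of "(A, c)"] mat_map_B1[OF Ac] by (simp add: w_def)
    then have "mor M x (lo r A) (w (lo r A)) = mor M x (hi r A) (w (hi r A))"
      using mor_comp[OF sc1D(5)[OF Ac] c(2) w[OF sc1D(3)[OF Ac]]]
        mor_comp[OF sc1D(6)[OF Ac] c(2) w[OF sc1D(4)[OF Ac]]] by simp
    with lh show ?thesis by auto
  qed simp
  have "\<forall>x\<in>I. \<exists>a. a \<in> sc I \<and> a \<le> x"
    using ex_sc_le by blast
  then obtain \<alpha> where \<alpha>: "\<And>x. x \<in> I \<Longrightarrow> \<alpha> x \<in> sc I \<and> \<alpha> x \<le> x"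
    by metis
  \<comment> \<open>Any source below x gives the same value by \<open>indep\<close>, so the
    arbitrary selection \<alpha> is harmless.\<close>
  define f where "f x = mor M x (\<alpha> x) (w (\<alpha> x))" for x
  have "from_interval M I f"
    unfolding from_interval_def
  proof (intro conjI ballI allI impI)
    show "f x \<in> obj M x" if "x \<in> I" for x
      using \<alpha>[OF that] w mor_in_obj by (simp add: f_def)
    fix x y assume xy: "x \<in> I" "x \<le> y"
    note \<alpha>x = \<alpha>[OF xy(1)]
    have \<alpha>y: "\<alpha> x \<le> y" using \<alpha>x xy(2) by auto
    have eq: "mor M y x (f x) = mor M y (\<alpha> x) (w (\<alpha> x))"
      unfolding f_def using \<alpha>x xy(2) w by (intro mor_comp) auto
    show "mor M y x (f x) = (if y \<in> I then f y else 0)"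
    proof (cases "y \<in> I")
      case True
      then show ?thesis
        using eq indep[of "\<alpha> x" "\<alpha> y" y] \<alpha>x \<alpha>y \<alpha>[OF True] by (simp add: f_def)
    next
      case False
      then have "y \<in> Up I" using xy by (auto simp: Up_def)
      then obtain a' where a': "a' \<in> sc (Up I)" "a' \<le> y" using ex_sc_le by blast
      note c = cm[OF a'(1)]
      \<comment> \<open>The row of M2 kills only the vector coming from the chosen source
        \<open>cm a'\<close>; by \<open>indep\<close> at y the source \<open>\<alpha> x\<close> can
        be exchanged for it.\<close>
      have "mor M y (\<alpha> x) (w (\<alpha> x)) = mor M y (cm a') (w (cm a'))"
        using \<alpha>x \<alpha>y c a'(2) by (intro indep) auto
      also have "\<dots> = mor M y a' (mor M a' (cm a') (w (cm a')))"
        using c a'(2) w by (intro mor_comp[symmetric]) auto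
      also have "\<dots> = mor M y a' 0"
        using z2[of a'] mat_map_B2[OF a'(1)] by (simp add: w_def)
      also have "\<dots> = 0"
        using lin_map_on_zero[OF linear_mor[OF a'(2)] subspace_obj] .
      finally show ?thesis using eq False by simp
    qed
  qed
  moreover have "f a = u (B1 a)" if a: "a \<in> sc I" for a
  proof -
    have "a \<in> I" using a sc_subset by blast
    then have "\<alpha> a = a"
      using \<alpha>[of a] a sc_subset unfolding sc_def by blast
    then show ?thesis using mor_id w[OF a] by (simp add: f_def w_def)
  qed
  ultimately show ?thesis by blast
qed

text \<open>In a row of M1 both sources are sent to the same vector, namely \<open>f c\<close> or 0
  according to whether c is in I. A row of M2 ends at a point outside I, where f is transported to
  0.\<close>

lemma from_interval_imp_kernel:
  assumes f: "from_interval M I f" and u: "\<And>a. a \<in> sc I \<Longrightarrow> u (B1 a) = f a"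
  shows "mat_map N u (B1 p) = 0" "mat_map N u (B2 a') = 0"
proof -
  note fD = from_intervalD[OF f]
  show "mat_map N u (B1 p) = 0"
  proof (cases "p \<in> sc1 r I")
    case True
    obtain A c where p: "p = (A, c)" by (cases p)
    with True have Ac: "(A, c) \<in> sc1 r I" by simp
    note D = sc1D[OF Ac]
    have "lo r A \<in> I" "hi r A \<in> I" using D sc_subset by blast+
    then show ?thesis
      unfolding p mat_map_B1[OF Ac] using D(3-6) fD(2) u by simp
  next
    case False
    then show ?thesis by (simp add: mat_map_outside row_idx_def)
  qed
  show "mat_map N u (B2 a') = 0"
  proof (cases "a' \<in> sc (Up I)")
    case True
    then have "a' \<notin> I" by (auto simp: sc_def Up_def)
    moreover have "cm a' \<in> I" using cm[OF True] sc_subset by blast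
    ultimately show ?thesis
      using mat_map_B2[OF True] cm[OF True] u fD(2) by simp
  next
    case False
    then show ?thesis by (simp add: mat_map_outside row_idx_def)
  qed
qed

text \<open>Together with \<open>mat_map_single_B3\<close> this places the individual columns of M4
  and M5 in \<open>low_image\<close>, so that a functional vanishing there can be tested on
  them.\<close>

lemma mat_map_single_B2:
  assumes b': "b' \<in> sk (Down I)" and v: "v \<in> obj M b'"
  shows "mat_map zero_block (single (B2 b') v) = single (B3 (dm b')) (mor M (dm b') b' v)"
proof
  fix i
  let ?u = "single (B2 b') v"
  \<comment> \<open>The first block of this family is 0, so the upper rows vanish by the kernel
    lemma applied to the zero morphism.\<close>
  have up: "mat_map zero_block ?u (B1 p) = 0" "mat_map zero_block ?u (B2 a') = 0" for p a'
    by (rule from_interval_imp_kernel[of "\<lambda>_. 0"];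
        use lin_map_on_zero[OF linear_mor subspace_obj] subspace_0[OF subspace_obj]
        in \<open>auto simp: from_interval_def single_def\<close>)+
  show "mat_map zero_block ?u i = single (B3 (dm b')) (mor M (dm b') b' v) i"
  proof (cases i)
    case (B3 b)
    show ?thesis
    proof (cases "b \<in> sk I")
      case True
      have "(\<Sum>b''\<in>sk (Down I). matM4 M dm b b'' (?u (B2 b''))) =
          (\<Sum>b''\<in>sk (Down I). if b'' = b' then matM4 M dm b b' v else 0)"
        using lin_map_on_zero[OF lin_matM4 subspace_obj] by (intro sum.cong) (auto simp: single_def)
      moreover have "(\<Sum>p\<in>sk1 q I. matM5 M q b p (?u (B3 p))) = 0"
        using lin_map_on_zero[OF lin_matM5 subspace_obj]
        by (intro sum.neutral) (auto simp: single_def)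
      ultimately show ?thesis
        using True b' B3
        by (simp add: mat_map_B3 zero_block_def low_row_def single_def) (simp add: matM4_def)
    next
      case False
      then show ?thesis
        using B3 dm[OF b'] by (auto simp: mat_map_outside row_idx_def single_def)
    qed
  qed (simp_all add: up)
qed

lemma mat_map_single_B3:
  assumes Bd: "(B, d) \<in> sk1 q I" and v: "v \<in> obj M d"
  shows "mat_map zero_block (single (B3 (B, d)) v) =
    single (B3 (lo q B)) (mor M (lo q B) d v) - single (B3 (hi q B)) (mor M (hi q B) d v)"
proof
  fix i
  let ?u = "single (B3 (B, d)) v"
  note D = sk1D[OF Bd]
  have up: "mat_map zero_block ?u (B1 p) = 0" "mat_map zero_block ?u (B2 a') = 0" for p a'
    by (rule from_interval_imp_kernel[of "\<lambda>_. 0"];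
        use lin_map_on_zero[OF linear_mor subspace_obj] subspace_0[OF subspace_obj]
        in \<open>auto simp: from_interval_def single_def\<close>)+
  show "mat_map zero_block ?u i =
    (single (B3 (lo q B)) (mor M (lo q B) d v) - single (B3 (hi q B)) (mor M (hi q B) d v)) i"
  proof (cases i)
    case (B3 b)
    show ?thesis
    proof (cases "b \<in> sk I")
      case True
      have "(\<Sum>p\<in>sk1 q I. matM5 M q b p (?u (B3 p))) =
          (\<Sum>p\<in>sk1 q I. if p = (B, d) then matM5 M q b (B, d) v else 0)"
        using lin_map_on_zero[OF lin_matM5 subspace_obj] by (intro sum.cong) (auto simp: single_def)
      moreover have "(\<Sum>b''\<in>sk (Down I). matM4 M dm b b'' (?u (B2 b''))) = 0"
        using lin_map_on_zero[OF lin_matM4 subspace_obj]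
        by (intro sum.neutral) (auto simp: single_def)
      ultimately have "mat_map zero_block ?u (B3 b) = matM5 M q b (B, d) v"
        using True Bd by (simp add: mat_map_B3 zero_block_def low_row_def)
      then show ?thesis
        using matM5_simps[OF Bd] D(2) B3
        by (cases "b = lo q B"; cases "b = hi q B") (auto simp: single_def)
    next
      case False
      then show ?thesis
        using B3 D by (auto simp: mat_map_outside row_idx_def single_def)
    qed
  qed (simp_all add: up)
qed

text \<open>The functional built from g at the sinks kills every column of the bottom rows. A column
  of M4 starts outside I, and g kills whatever arrives from there; in a column of M5 both terms
  reduce to the same value, g at d or 0, with opposite signs.\<close>

lemma to_interval_low_row:
  assumes g: "to_interval s M I g" and u: "u \<in> sources"
  shows "(\<Sum>b\<in>sk I. g b (low_row u b)) = 0"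
proof -
  note gD = to_intervalD[OF g]
  have skI: "b \<in> I" if "b \<in> sk I" for b using that sk_subset by blast
  note u4 = sourcesD(2)[OF u] and u5 = sourcesD(3)[OF u]
  have m4: "matM4 M dm b b' (u (B2 b')) \<in> obj M b" if "b' \<in> sk (Down I)" for b b'
    using lin_map_onD(1)[OF lin_matM4[OF that] u4[OF that]] .
  have m5: "matM5 M q b p (u (B3 p)) \<in> obj M b" if "p \<in> sk1 q I" for b p
    using lin_map_onD(1)[OF lin_matM5[OF that] u5[OF that]] .
  have g0: "g b 0 = 0" if "b \<in> sk I" for b
    using lin_map_on_zero[OF gD(1)[OF skI[OF that]] subspace_obj] .
  have "g b (low_row u b) = (\<Sum>b'\<in>sk (Down I). g b (matM4 M dm b b' (u (B2 b')))) +
      (\<Sum>p\<in>sk1 q I. g b (matM5 M q b p (u (B3 p))))" if "b \<in> sk I" for b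
    unfolding low_row_def using m4 m5
    by (subst lin_map_onD(2)[OF gD(1)[OF skI[OF that]]])
      (auto intro!: subspace_sum[OF subspace_obj]
        simp: lin_map_on_sum[OF gD(1)[OF skI[OF that]] subspace_obj])
  then have eq: "(\<Sum>b\<in>sk I. g b (low_row u b)) =
      (\<Sum>b'\<in>sk (Down I). \<Sum>b\<in>sk I. g b (matM4 M dm b b' (u (B2 b')))) +
      (\<Sum>p\<in>sk1 q I. \<Sum>b\<in>sk I. g b (matM5 M q b p (u (B3 p))))"
    by (simp add: sum.distrib sum.swap[of _ "sk I"])
  have s4: "(\<Sum>b\<in>sk I. g b (matM4 M dm b b' (u (B2 b')))) = 0" if b': "b' \<in> sk (Down I)" for b'
  proof (rule sum.neutral, intro ballI)
    fix b assume b: "b \<in> sk I"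
    have "b' \<notin> I" using b' by (auto simp: sk_def Down_def)
    then show "g b (matM4 M dm b b' (u (B2 b'))) = 0"
      using gD(2)[OF skI[OF b] _ u4[OF b']] dm[OF b'] g0[OF b] by (auto simp: matM4_def)
  qed
  have s5: "(\<Sum>b\<in>sk I. g b (matM5 M q b p (u (B3 p)))) = 0" if p: "p \<in> sk1 q I" for p
  proof -
    obtain B d where Bd: "p = (B, d)" by (cases p)
    note D = sk1D[OF p[unfolded Bd]] and m = matM5_simps[OF p[unfolded Bd]]
    have ud: "u (B3 p) \<in> obj M d" using u5[OF p] Bd by simp
    have "(\<Sum>b\<in>sk I. g b (matM5 M q b p (u (B3 p)))) =
        g (lo q B) (matM5 M q (lo q B) p (u (B3 p))) + g (hi q B) (matM5 M q (hi q B) p (u (B3 p)))"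
      unfolding Bd using D m(3) g0 by (intro sum_two_support) auto
    \<comment> \<open>Negation is written as subtraction from 0 so that
      \<open>lin_map_on_diff\<close> applies.\<close>
    also have "\<dots> = g (lo q B) (mor M (lo q B) d (u (B3 p))) +
        g (hi q B) (0 - mor M (hi q B) d (u (B3 p)))"
      using m(1,2) Bd by simp
    also have "g (hi q B) (0 - mor M (hi q B) d (u (B3 p))) =
        0 - g (hi q B) (mor M (hi q B) d (u (B3 p)))"
      using lin_map_on_diff[OF gD(1)[OF skI[OF D(4)]] subspace_obj subspace_0[OF subspace_obj]
          mor_in_obj[OF D(6) ud]] g0[OF D(4)] by simp
    finally show ?thesis
      using gD(2)[OF skI[OF D(3)] D(5) ud] gD(2)[OF skI[OF D(4)] D(6) ud] by simp
  qed
  show ?thesis unfolding eq by (simp add: s4 s5)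
qed

end


section \<open>The difference of the ranks\<close>

lemma lin_map_on_functional_families:
  assumes "\<And>b. b \<in> S \<Longrightarrow> lin_map_on s (*) (V b) UNIV (g b :: 'v::ab_group_add \<Rightarrow> 'k::field)"
  shows "lin_map_on (fam_scale s) (*) {w. \<forall>b\<in>S. w (e b) \<in> V b} UNIV (\<lambda>w. \<Sum>b\<in>S. g b (w (e b)))"
  using lin_map_onD[OF assms]
  by (auto simp: lin_map_on_def fam_scale_def sum.distrib[symmetric] sum_distrib_left
      intro!: sum.cong)

context interval_matrices
begin

section \<open>Projection to the upper block rows\<close>

sublocale src: vector_space "fam_scale s :: 'k \<Rightarrow> (('p, 'p, 'p set \<times> 'p) blk \<Rightarrow> 'v) \<Rightarrow> _"
  by (rule vector_space_fam_scale)

sublocale tgt: vector_space "fam_scale s :: 'k \<Rightarrow> (('p set \<times> 'p, 'p, 'p) blk \<Rightarrow> 'v) \<Rightarrow> _"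
  by (rule vector_space_fam_scale)

lemma subspace_col_src: "subspace (col_src M c)"
  by (cases c) (auto simp: col_src_def blk_row_def subspace_obj split_beta)

lemma findim_row_tgt: "findim (row_tgt i)"
  by (cases i) (auto simp: row_tgt_def blk_row_def findim_obj split_beta)

lemma subspace_sources: "src.subspace sources"
  using subspace_0[OF subspace_col_src] subspace_add[OF subspace_col_src] subspace_scale[OF subspace_col_src]
  by (auto simp: src.subspace_def sources_def fam_scale_def)

lemma subspace_targets: "tgt.subspace targets"
  using subspace_0[OF subspace_row_tgt] subspace_add[OF subspace_row_tgt] subspace_scale[OF subspace_row_tgt]
  by (simp add: tgt.subspace_def targets_def fam_scale_def)

lemma findim_targets: "tgt.findim targets"
  unfolding targets_def by (rule findim_families) (simp_all add: findim_row_tgt row_idx_def blk_sets_def)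

lemma single_in_sources:
  assumes "v \<in> col_src M c"
  shows "single c v \<in> sources"
proof -
  have "single c v c' \<in> col_src M c'" for c'
    using assms subspace_0[OF subspace_col_src[of c']] by (cases "c' = c") auto
  then show ?thesis by (simp add: sources_def)
qed

text \<open>The projection is kept as an endomorphism of the full family space because
  \<open>dim_kernel_image\<close> is stated for endomorphisms.\<close>

definition drop_low :: "(('p set \<times> 'p, 'p, 'p) blk \<Rightarrow> 'v) \<Rightarrow> _" where
  "drop_low w = (\<lambda>i. case i of B3 b \<Rightarrow> 0 | _ \<Rightarrow> w i)"

lemma drop_low_eq_0_iff:
  "drop_low w = 0 \<longleftrightarrow> (\<forall>p. w (B1 p) = 0) \<and> (\<forall>a'. w (B2 a') = 0)"
  by (auto simp: drop_low_def fun_eq_iff split: blk.split)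

lemma module_hom_drop_low: "module_hom (fam_scale s) (fam_scale s) drop_low"
  unfolding module_hom_iff_linear Vector_Spaces.linear_iff
  using tgt.vector_space_axioms
  by (auto simp: drop_low_def fam_scale_def fun_eq_iff split: blk.split)

text \<open>The lower left block being 0 here, this is the column space of M4 and M5 placed in the
  bottom rows.\<close>

definition "low_image = {w \<in> mat_map zero_block ` sources. drop_low w = 0}"

lemma lin_mat_maps:
  "lin_map_on (fam_scale s) (fam_scale s) sources targets (mat_map (matM3 M b0 a0))"
  "lin_map_on (fam_scale s) (fam_scale s) sources targets (mat_map zero_block)"
  by (intro lin_mat_map lin_matM3 lin_zero_block)+

lemma subspace_drop_low_kernel:
  assumes "tgt.subspace S"
  shows "tgt.subspace {w \<in> S. drop_low w = 0}"
proof -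
  interpret h: module_hom "fam_scale s" "fam_scale s" drop_low
    by (rule module_hom_drop_low)
  have "{w \<in> S. drop_low w = 0} = S \<inter> {w. drop_low w = 0}" by blast
  then show ?thesis
    using tgt.subspace_inter[OF assms h.subspace_kernel] by simp
qed

lemma subspace_images:
  "tgt.subspace (mat_map (matM3 M b0 a0) ` sources)" "tgt.subspace (mat_map zero_block ` sources)"
  using src.lin_map_on_image[OF _ subspace_sources tgt.vector_space_axioms] lin_mat_maps by auto

lemma images_subset_targets:
  "mat_map (matM3 M b0 a0) ` sources \<subseteq> targets" "mat_map zero_block ` sources \<subseteq> targets"
  using lin_map_onD(1)[OF lin_mat_maps(1)] lin_map_onD(1)[OF lin_mat_maps(2)] by blast+

lemma subspace_low_image: "tgt.subspace low_image"
  unfolding low_image_def by (intro subspace_drop_low_kernel subspace_images)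

text \<open>Vanishing upper rows mean that the first block of the family is the restriction of a
  morphism f to the sources. Then M3 adds \<open>mor M b0 a0 (f a0)\<close>, which is
  \<open>f b0\<close>, while the other two block columns produce a vector of
  \<open>low_image\<close> independently of f.\<close>

lemma kernel_with_matM3:
  "{w \<in> mat_map (matM3 M b0 a0) ` sources. drop_low w = 0} =
    {l + single (B3 b0) (f b0) | l f. l \<in> low_image \<and> from_interval M I f}" (is "?X = ?Y")
proof
  have b0I: "b0 \<in> I" and a0I: "a0 \<in> I"
    using b0 a0 sk_subset sc_subset by blast+
  have mor_f: "mor M b0 a0 (f a0) = f b0" if "from_interval M I f" for f
    using from_intervalD(2)[OF that a0I a0_le_b0] b0I by simp
  have drop: "drop_low (mat_map (matM3 M b0 a0) u) = drop_low (mat_map zero_block u)" for u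
    by (auto simp: drop_low_def mat_map_matM3 single_def split: blk.split)
  show "?X \<subseteq> ?Y"
  proof
    fix w assume "w \<in> ?X"
    then obtain u where u: "u \<in> sources" and w: "w = mat_map (matM3 M b0 a0) u" "drop_low w = 0"
      by blast
    have "drop_low (mat_map zero_block u) = 0" using w drop by simp
    moreover from this obtain f where f: "from_interval M I f" "\<forall>a\<in>sc I. f a = u (B1 a)"
      using kernel_imp_from_interval[OF u] unfolding drop_low_eq_0_iff by blast
    ultimately have "mat_map zero_block u \<in> low_image"
      using u by (auto simp: low_image_def)
    moreover have "w = mat_map zero_block u + single (B3 b0) (f b0)"
      using w(1) f(2) a0 mor_f[OF f(1)] by (simp add: mat_map_matM3)
    ultimately show "w \<in> ?Y" using f(1) by blast
  qed
  show "?Y \<subseteq> ?X"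
  proof
    fix w assume "w \<in> ?Y"
    then obtain l f where w: "w = l + single (B3 b0) (f b0)" and l: "l \<in> low_image"
      and f: "from_interval M I f" by blast
    obtain u where u: "u \<in> sources" "l = mat_map zero_block u"
      using l by (auto simp: low_image_def)
    \<comment> \<open>The second and third blocks are those of u, which reproduces l in the bottom
      rows; the first block is replaced by f.\<close>
    define u' where "u' c = (case c of B1 a \<Rightarrow> if a \<in> sc I then f a else 0 | _ \<Rightarrow> u c)" for c
    have "u' c \<in> col_src M c" if "c \<in> cols" for c
    proof (cases c)
      case (B1 a)
      then have "a \<in> sc I" using that by (simp add: col_idx_def)
      moreover from this have "f a \<in> obj M a"
        using from_intervalD(1)[OF f] sc_subset by blast
      ultimately show ?thesis using B1 by (simp add: u'_def col_src_def blk_row_def)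
    qed (use u(1) that in \<open>simp_all add: u'_def sources_def\<close>)
    then have u': "u' \<in> sources" by (simp add: sources_def)
    have z: "mat_map zero_block u' (B1 p) = 0" "mat_map zero_block u' (B2 a') = 0" for p a'
      using from_interval_imp_kernel[OF f, of u'] by (simp_all add: u'_def)
    have "mat_map zero_block u' = l"
    proof
      fix i
      show "mat_map zero_block u' i = l i"
      proof (cases i)
        case (B3 b)
        then show ?thesis
          unfolding u(2)
          by (cases "b \<in> sk I")
            (simp_all add: mat_map_B3 zero_block_def low_row_def u'_def mat_map_outside row_idx_def)
      qed (use l z in \<open>auto simp: low_image_def drop_low_eq_0_iff\<close>)
    qed
    then have "mat_map (matM3 M b0 a0) u' = w"
      using w mor_f[OF f] a0 by (simp add: mat_map_matM3 u'_def)
    moreover have "drop_low w = 0"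
      using w l by (auto simp: low_image_def drop_low_eq_0_iff)
    ultimately show "w \<in> ?X" using u' by blast
  qed
qed

text \<open>Dual to \<open>kernel_imp_from_interval\<close>: the functionals at the sinks are pulled
  back along the structure maps. Vanishing on the columns of M5 makes the pullback independent of
  the sink, vanishing on those of M4 makes it 0 at the points of \<open>Down I\<close>.\<close>

lemma functional_imp_to_interval:
  assumes G: "lin_map_on (fam_scale s) (*) UNIV UNIV G" and G0: "\<And>w. w \<in> low_image \<Longrightarrow> G w = 0"
  shows "\<exists>g. to_interval s M I g \<and>
    (\<forall>b\<in>sk I. \<forall>v\<in>obj M b. g b v = (G (single (B3 b) v) :: 'k))"
proof -
  define h where "h b v = G (single (B3 b) v)" for b v
  have h: "lin_map_on s (*) UNIV UNIV (h b)" for b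
    using lin_map_onD[OF G] by (simp add: lin_map_on_def h_def single_add single_scale)
  have indep: "h b (mor M b x v) = h b' (mor M b' x v)"
    if b: "b \<in> sk I" "b' \<in> sk I" "x \<le> b" "x \<le> b'" and v: "v \<in> obj M x" for b b' x v
  proof (cases "b = b'")
    case False
    define B where "B = {b, b'}"
    have B: "B \<subseteq> sk I" "card B = 2" using b False by (auto simp: B_def)
    note p = lo_hi_pair[OF q B]
    then have lh: "lo q B = b \<and> hi q B = b' \<or> lo q B = b' \<and> hi q B = b"
      by (auto simp: B_def doubleton_eq_iff)
    then have "x \<in> {..lo q B} \<inter> {..hi q B}" using b by auto
    then obtain d where d: "d \<in> wedge q B" "x \<le> d"
      using ex_sk_ge[of x "{..lo q B} \<inter> {..hi q B}"] by (auto simp: wedge_def)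
    then have Bd: "(B, d) \<in> sk1 q I" using B by (auto simp: sk1_def)
    define v' where "v' = mor M d x v"
    have v': "v' \<in> obj M d" using mor_in_obj[OF d(2) v] by (simp add: v'_def)
    \<comment> \<open>The column of M5 at d, evaluated at the transported vector \<open>v'\<close>:
      G vanishes on it, so the two sinks give equal values.\<close>
    let ?w = "single (B3 (lo q B)) (mor M (lo q B) d v') - single (B3 (hi q B)) (mor M (hi q B) d v')"
    have "mat_map zero_block (single (B3 (B, d)) v') = ?w"
      by (rule mat_map_single_B3[OF Bd v'])
    moreover have "single (B3 (B, d)) v' \<in> sources"
      using v' by (intro single_in_sources) (simp add: col_src_def blk_row_def)
    ultimately have "?w \<in> low_image"
      by (auto simp: low_image_def drop_low_eq_0_iff intro: image_eqI[rotated])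
    then have "G ?w = 0" by (rule G0)
    then have "h (lo q B) (mor M (lo q B) d v') = h (hi q B) (mor M (hi q B) d v')"
      using tgt.lin_map_on_diff[OF G tgt.subspace_UNIV UNIV_I UNIV_I] by (simp add: h_def)
    then have "h (lo q B) (mor M (lo q B) x v) = h (hi q B) (mor M (hi q B) x v)"
      using mor_comp[OF d(2) sk1D(5)[OF Bd] v] mor_comp[OF d(2) sk1D(6)[OF Bd] v]
      by (simp add: v'_def)
    with lh show ?thesis by auto
  qed simp
  have "\<forall>x\<in>I. \<exists>b. b \<in> sk I \<and> x \<le> b"
    using ex_sk_ge by blast
  then obtain \<beta> where \<beta>: "\<And>x. x \<in> I \<Longrightarrow> \<beta> x \<in> sk I \<and> x \<le> \<beta> x"
    by metis
  define g where "g x v = h (\<beta> x) (mor M (\<beta> x) x v)" for x v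
  have "to_interval s M I g"
    unfolding to_interval_def
  proof (intro conjI ballI allI impI)
    show "lin_map_on s (*) (obj M x) UNIV (g x)" if "x \<in> I" for x
      unfolding g_def using \<beta>[OF that]
      by (intro lin_map_on_compose[OF linear_mor] lin_map_on_subset[OF h]) auto
    fix x y v assume xy: "x \<le> y" "y \<in> I" and v: "v \<in> obj M x"
    note \<beta>y = \<beta>[OF xy(2)]
    have x\<beta>: "x \<le> \<beta> y" using xy(1) \<beta>y by auto
    have eq: "g y (mor M y x v) = h (\<beta> y) (mor M (\<beta> y) x v)"
      using mor_comp[OF xy(1) _ v] \<beta>y by (simp add: g_def)
    show "g y (mor M y x v) = (if x \<in> I then g x v else 0)"
    proof (cases "x \<in> I")
      case True
      then show ?thesis
        using eq indep[of "\<beta> y" "\<beta> x" x v] \<beta>[OF True] \<beta>y x\<beta> v by (simp add: g_def)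
    next
      case False
      then have "x \<in> Down I" using xy by (auto simp: Down_def)
      then obtain b' where b': "b' \<in> sk (Down I)" "x \<le> b'" using ex_sk_ge by blast
      note d = dm[OF b'(1)]
      define v' where "v' = mor M b' x v"
      have v': "v' \<in> obj M b'" using mor_in_obj[OF b'(2) v] by (simp add: v'_def)
      have "single (B2 b') v' \<in> sources"
        using v' by (intro single_in_sources) (simp add: col_src_def blk_row_def)
      then have "single (B3 (dm b')) (mor M (dm b') b' v') \<in> low_image"
        using mat_map_single_B2[OF b'(1) v']
        by (auto simp: low_image_def drop_low_eq_0_iff intro: image_eqI[rotated])
      then have "h (dm b') (mor M (dm b') b' v') = 0"
        unfolding h_def by (rule G0)
      then have "h (dm b') (mor M (dm b') x v) = 0"
        using mor_comp[OF b'(2) _ v] d by (simp add: v'_def)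
      \<comment> \<open>The column of M4 speaks only of the sink \<open>dm b'\<close>;
        \<open>indep\<close> at x exchanges \<open>\<beta> y\<close> for it.\<close>
      moreover have "h (\<beta> y) (mor M (\<beta> y) x v) = h (dm b') (mor M (dm b') x v)"
        using \<beta>y x\<beta> d b'(2) v by (intro indep) auto
      ultimately show ?thesis using eq False by simp
    qed
  qed
  moreover have "g b v = G (single (B3 b) v)" if b: "b \<in> sk I" and v: "v \<in> obj M b" for b v
  proof -
    have "b \<in> I" using b sk_subset by blast
    then have "\<beta> b = b"
      using \<beta>[of b] b sk_subset unfolding sk_def by blast
    then show ?thesis using mor_id[OF v] by (simp add: g_def h_def)
  qed
  ultimately show ?thesis by blast
qed

text \<open>A functional separating \<open>f b0\<close> from \<open>low_image\<close> becomes a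
  morphism g from M to the interval module with \<open>g b0 (f b0) = 1\<close>. Restricted to U it
  still composes with f to a nonzero scalar, which forces the isomorphism because U is
  indecomposable.\<close>

lemma iso_if_not_in_low_image:
  assumes U: "submod s M U" and ind: "indecomposable s (restr M U)"
    and f: "from_interval (restr M U) I f" and nin: "single (B3 b0) (f b0) \<notin> low_image"
  shows "pmod_iso s (restr M U) ((*) :: 'k \<Rightarrow> _) (interval_module I)"
proof -
  have b0I: "b0 \<in> I" using b0 sk_subset by blast
  obtain G where G: "lin_map_on (fam_scale s) (*) UNIV UNIV G" "\<forall>w\<in>low_image. G w = 0"
      "G (single (B3 b0) (f b0)) = (1 :: 'k)"
    using tgt.separating_functional[OF subspace_low_image nin] by metis
  obtain g where g: "to_interval s M I g"
      "\<And>b v. b \<in> sk I \<Longrightarrow> v \<in> obj M b \<Longrightarrow> g b v = G (single (B3 b) v)"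
    using functional_imp_to_interval[OF G(1)] G(2) by metis
  have "to_interval s (restr M U) I g"
    using g(1) submodD(2)[OF U] unfolding to_interval_def lin_map_on_def by simp
  moreover have "f b0 \<in> obj M b0"
    using from_intervalD(1)[OF f b0I] submodD(2)[OF U] by simp
  then have "g b0 (f b0) \<noteq> 0"
    using g(2)[OF b0] G(3) by simp
  ultimately show ?thesis
    using pmodule.indecomposable_iso_interval_module[OF pmodule_restr[OF U] I ind f _ b0I] by blast
qed

text \<open>Modulo \<open>low_image\<close> the kernel with M3 has a basis indexed by the summands
  isomorphic to the interval module: each contributes its generator at b0. Every other summand
  contributes only vectors of \<open>low_image\<close>, and the upper rows cancel.\<close>

lemma dim_difference:
  assumes D: "indec_decomposition s M n U"
  shows "tgt.dim (mat_map (matM3 M b0 a0) ` sources) = tgt.dim (mat_map zero_block ` sources) +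
    card {j. j < n \<and> pmod_iso s (restr M (U j)) ((*) :: 'k \<Rightarrow> _) (interval_module I)}"
    (is "tgt.dim ?X = tgt.dim ?Y + card ?J")
proof -
  have b0I: "b0 \<in> I" using b0 sk_subset by blast
  have DS: "direct_sum s M n U" and ind: "\<And>j. j < n \<Longrightarrow> indecomposable s (restr M (U j))"
    using D by (auto simp: indec_decomposition_def)
  note sub = direct_sumD(1)[OF DS]
  obtain p where p_lin: "\<And>j x. j < n \<Longrightarrow> lin_map_on s s (obj M x) (U j x) (p j x)"
    and p_sum: "\<And>x v. v \<in> obj M x \<Longrightarrow> v = (\<Sum>j<n. p j x v)"
    and p_mor: "\<And>j x y v. j < n \<Longrightarrow> x \<le> y \<Longrightarrow> v \<in> obj M x \<Longrightarrow>
      p j y (mor M y x v) = mor M y x (p j x v)"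
    and p_U: "\<And>i j x v. i < n \<Longrightarrow> j < n \<Longrightarrow> v \<in> U j x \<Longrightarrow> p i x v = (if i = j then v else 0)"
    by (rule direct_sum_projections[OF DS]) (rule that)
  have p0: "p j x 0 = 0" if "j < n" for j x
    using lin_map_on_zero[OF p_lin[OF that] subspace_obj] .
  define inverse_pair where "inverse_pair j f g \<longleftrightarrow>
      from_interval (restr M (U j)) I f \<and> to_interval s (restr M (U j)) I g \<and>
      (\<forall>x\<in>I. \<forall>v\<in>U j x. v = s (g x v) (f x)) \<and> (\<forall>x\<in>I. g x (f x) = (1::'k))" for j f g
  have "\<forall>j\<in>?J. \<exists>f. \<exists>g. inverse_pair j f g"
  proof
    fix j assume j: "j \<in> ?J"
    have M': "pmodule s (restr M (U j))" using j pmodule_restr sub by blast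
    have iso: "pmod_iso s (restr M (U j)) ((*) :: 'k \<Rightarrow> _) (interval_module I)" using j by blast
    obtain f g where "from_interval (restr M (U j)) I f" "to_interval s (restr M (U j)) I g"
      "\<And>x v. x \<in> I \<Longrightarrow> v \<in> obj (restr M (U j)) x \<Longrightarrow> v = s (g x v) (f x)"
      "\<And>x. x \<in> I \<Longrightarrow> g x (f x) = (1::'k)"
      using pmod_iso_interval_moduleE[OF M' iso] by blast
    then have "inverse_pair j f g" unfolding inverse_pair_def by simp
    then show "\<exists>f. \<exists>g. inverse_pair j f g" by blast
  qed
  from bchoice[OF this] obtain f where "\<forall>j\<in>?J. \<exists>g. inverse_pair j (f j) g" ..
  from bchoice[OF this] obtain g' where "\<forall>j\<in>?J. inverse_pair j (f j) (g' j)" ..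
  then have "inverse_pair j (f j) (g' j)" if "j \<in> ?J" for j
    using that by (rule bspec)
  note fg = this[unfolded inverse_pair_def]
  \<comment> \<open>\<open>g' j\<close> belongs to the summand alone; composing with the projection
    extends it to M and makes it vanish on the other summands, hence the duality
    \<open>gf\<close>.\<close>
  define g where "g j x v = g' j x (p j x v)" for j x v
  have f: "from_interval (restr M (U j)) I (f j)" if "j \<in> ?J" for j
    using fg[OF that] by blast
  have fU: "f j x \<in> U j x" if "j \<in> ?J" "x \<in> I" for j x
    using from_intervalD(1)[OF f[OF that(1)] that(2)] by simp
  have g: "to_interval s M I (g j)" if "j \<in> ?J" for j
  proof -
    have j: "j < n" and g'j: "to_interval s (restr M (U j)) I (g' j)"
      using that fg[OF that] by auto
    show ?thesis
      unfolding to_interval_def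
    proof (intro conjI ballI allI impI)
      show "lin_map_on s (*) (obj M x) UNIV (g j x)" if "x \<in> I" for x
        unfolding g_def
        using lin_map_on_compose[OF p_lin[OF j]] to_intervalD(1)[OF g'j that] by simp
      fix x y v assume xy: "x \<le> y" "y \<in> I" and v: "v \<in> obj M x"
      have "p j x v \<in> U j x" using lin_map_onD(1)[OF p_lin[OF j] v] .
      then show "g j y (mor M y x v) = (if x \<in> I then g j x v else 0)"
        unfolding g_def p_mor[OF j xy(1) v] using to_intervalD(2)[OF g'j xy(2,1)] by simp
    qed
  qed
  have gf: "g i x (f j x) = (if i = j then 1 else 0)" if "i \<in> ?J" "j \<in> ?J" "x \<in> I" for i j x
  proof -
    have "g' i x 0 = 0"
      using fg[OF that(1)] to_intervalD(1)[of s "restr M (U i)" I "g' i" x] that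
        lin_map_on_zero[of "(*)" "U i x"] submodD(1)[OF sub] by auto
    moreover have "p i x (f j x) = (if i = j then f j x else 0)"
      using that fU[OF that(2,3)] by (intro p_U) auto
    ultimately show ?thesis
      using fg[OF that(1)] that(3) by (auto simp: g_def)
  qed
  have gs: "p j x v = s (g j x v) (f j x)" if "j \<in> ?J" "x \<in> I" "v \<in> obj M x" for j x v
    using fg[OF that(1)] lin_map_onD(1)[OF p_lin that(3), of j] that by (auto simp: g_def)
  define w where "w j = (single (B3 b0) (f j b0) :: ('p set \<times> 'p, 'p, 'p) blk \<Rightarrow> 'v)" for j
  have span: "{w \<in> ?X. drop_low w = 0} = tgt.span (low_image \<union> w ` ?J)"
  proof
    have "low_image \<union> w ` ?J \<subseteq> {w \<in> ?X. drop_low w = 0}"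
    proof -
      have zero: "from_interval M I (\<lambda>_. 0)"
        using lin_map_on_zero[OF linear_mor subspace_obj] subspace_0[OF subspace_obj]
        by (simp add: from_interval_def)
      have "l \<in> {w \<in> ?X. drop_low w = 0}" if "l \<in> low_image" for l
        unfolding kernel_with_matM3 using zero that
        by (intro CollectI exI[of _ l] exI[of _ "\<lambda>_. 0"]) (simp add: single_zero)
      moreover have "w j \<in> {w \<in> ?X. drop_low w = 0}" if j: "j \<in> ?J" for j
      proof -
        have "from_interval M I (f j)"
          using f[OF j] submodD(2)[OF sub] j by (auto simp: from_interval_def)
        then show ?thesis
          unfolding kernel_with_matM3 using tgt.subspace_0[OF subspace_low_image]
          by (intro CollectI exI[of _ 0] exI[of _ "f j"]) (simp add: w_def)
      qed
      ultimately show ?thesis by blast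
    qed
    then show "tgt.span (low_image \<union> w ` ?J) \<subseteq> {w \<in> ?X. drop_low w = 0}"
      by (intro tgt.span_minimal subspace_drop_low_kernel subspace_images)
    show "{w \<in> ?X. drop_low w = 0} \<subseteq> tgt.span (low_image \<union> w ` ?J)"
    proof
      fix z assume "z \<in> {w \<in> ?X. drop_low w = 0}"
      then obtain l e where z: "z = l + single (B3 b0) (e b0)" and l: "l \<in> low_image"
        and e: "from_interval M I e"
        unfolding kernel_with_matM3 by blast
      have eM: "e x \<in> obj M x" if "x \<in> I" for x using from_intervalD(1)[OF e that] .
      \<comment> \<open>The value \<open>e b0\<close> is split along the decomposition. In a summand
        isomorphic to the interval module the component is a multiple of \<open>f j b0\<close>; in
        any other it lies in \<open>low_image\<close>.\<close>
      have "single (B3 b0) (p j b0 (e b0)) \<in> tgt.span (low_image \<union> w ` ?J)" if j: "j < n" for j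
      proof (cases "j \<in> ?J")
        case True
        have "single (B3 b0) (p j b0 (e b0)) = fam_scale s (g j b0 (e b0)) (w j)"
          using gs[OF True b0I eM[OF b0I]] by (simp add: w_def single_scale)
        moreover have "w j \<in> tgt.span (low_image \<union> w ` ?J)"
          using True by (intro tgt.span_base) blast
        ultimately show ?thesis by (simp only: tgt.span_scale)
      next
        case False
        have "from_interval (restr M (U j)) I (\<lambda>x. p j x (e x))"
          unfolding from_interval_def
        proof (intro conjI ballI allI impI)
          fix x y assume xy: "x \<in> I" "x \<le> y"
          show "mor (restr M (U j)) y x (p j x (e x)) = (if y \<in> I then p j y (e y) else 0)"
            using p_mor[OF j xy(2) eM[OF xy(1)]] from_intervalD(2)[OF e xy] p0[OF j] by (simp split: if_splits)
        qed (use lin_map_onD(1)[OF p_lin[OF j] eM] in simp)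
        then have "single (B3 b0) (p j b0 (e b0)) \<in> low_image"
          using iso_if_not_in_low_image[OF sub[OF j] ind[OF j]] False j by blast
        then show ?thesis by (intro tgt.span_base) blast
      qed
      then have "(\<Sum>j<n. single (B3 b0) (p j b0 (e b0))) \<in> tgt.span (low_image \<union> w ` ?J)"
        by (intro tgt.span_sum) auto
      then have "single (B3 b0) (e b0) \<in> tgt.span (low_image \<union> w ` ?J)"
        unfolding single_sum[symmetric] p_sum[OF eM[OF b0I], symmetric] .
      then show "z \<in> tgt.span (low_image \<union> w ` ?J)"
        unfolding z using l by (intro tgt.span_add[OF tgt.span_base]) auto
    qed
  qed
  have sk_targets: "z (B3 b) \<in> obj M b" if "z \<in> targets" "b \<in> sk I" for z b
  proof -
    have "B3 b \<in> rows"
      using that(2) by (simp add: row_idx_def)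
    then have "z (B3 b) \<in> row_tgt (B3 b)"
      using that(1) unfolding targets_def by blast
    then show ?thesis by (simp add: row_tgt_def blk_row_def)
  qed
  have low_targets: "low_image \<subseteq> targets"
    using images_subset_targets(2) by (auto simp: low_image_def)
  have skI: "b \<in> I" if "b \<in> sk I" for b using that sk_subset by blast
  \<comment> \<open>The functional of \<open>g j\<close> sums over all sinks, as it must to kill
    \<open>low_image\<close>, but on \<open>w i\<close> only its term at b0 survives.\<close>
  have "tgt.dim (tgt.span (low_image \<union> w ` ?J)) = tgt.dim low_image + card ?J"
  proof (rule tgt.dim_span_Un_dual[OF subspace_targets low_targets,
        where G = "\<lambda>j z. \<Sum>b\<in>sk I. g j b (z (B3 b))"])
    show "tgt.findim low_image"
      using tgt.findim_subset[OF findim_targets low_targets] .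
    fix j assume j: "j \<in> ?J"
    have "w j \<in> {w \<in> ?X. drop_low w = 0}"
      unfolding span using j by (intro tgt.span_base) blast
    then show "w j \<in> targets" using images_subset_targets(1) by blast
    show "lin_map_on (fam_scale s) (*) targets UNIV (\<lambda>z. \<Sum>b\<in>sk I. g j b (z (B3 b)))"
    proof (rule lin_map_on_subset[OF lin_map_on_functional_families])
      show "lin_map_on s (*) (obj M b) UNIV (g j b)" if "b \<in> sk I" for b
        using to_intervalD(1)[OF g[OF j] skI[OF that]] .
    qed (use sk_targets in auto)
    show "(\<Sum>b\<in>sk I. g j b (z (B3 b))) = 0" if z: "z \<in> low_image" for z
    proof -
      obtain u where u: "u \<in> sources" "z = mat_map zero_block u"
        using z by (auto simp: low_image_def)
      have "(\<Sum>b\<in>sk I. g j b (z (B3 b))) = (\<Sum>b\<in>sk I. g j b (low_row u b))"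
        by (intro sum.cong refl) (simp add: u(2) mat_map_B3 zero_block_def)
      then show ?thesis using to_interval_low_row[OF g[OF j] u(1)] by simp
    qed
    fix i assume i: "i \<in> ?J"
    have "(\<Sum>b\<in>sk I. g j b (w i (B3 b))) = (\<Sum>b\<in>sk I. if b = b0 then g j b0 (f i b0) else 0)"
      using lin_map_on_zero[OF to_intervalD(1)[OF g[OF j] skI] subspace_obj]
      by (intro sum.cong) (auto simp: w_def single_def)
    then show "(\<Sum>b\<in>sk I. g j b (w i (B3 b))) = (if j = i then 1 else 0)"
      using gf[OF j i b0I] b0 by simp
  qed simp
  \<comment> \<open>M3 changes only a bottom row, so both matrices have the same upper part and its
    dimension cancels.\<close>
  moreover have "drop_low ` ?X = drop_low ` ?Y"
  proof -
    have "drop_low (mat_map (matM3 M b0 a0) u) = drop_low (mat_map zero_block u)" for u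
      by (auto simp: drop_low_def mat_map_matM3 single_def split: blk.split)
    then show ?thesis by (simp add: image_image)
  qed
  moreover have "tgt.dim ?X = tgt.dim {w \<in> ?X. drop_low w = 0} + tgt.dim (drop_low ` ?X)"
    using tgt.findim_subset[OF findim_targets images_subset_targets(1)]
    by (intro tgt.dim_kernel_image subspace_images module_hom_drop_low)
  moreover have "tgt.dim ?Y = tgt.dim low_image + tgt.dim (drop_low ` ?Y)"
    unfolding low_image_def
    using tgt.findim_subset[OF findim_targets images_subset_targets(2)]
    by (intro tgt.dim_kernel_image subspace_images module_hom_drop_low)
  ultimately show ?thesis by (simp add: span)
qed

end

theorem mainTheorem1:
  fixes s :: "'k::field \<Rightarrow> 'v::ab_group_add \<Rightarrow> 'v"
    and M :: "('p::{order,finite}, 'v) pmod"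
    and I :: "'p set"
    and r q :: "'p rel"
    and cm dm :: "'p \<Rightarrow> 'p"
    and a0 b0 :: 'p
  assumes "pmodule s M"
    and "interval I"
    and "linear_order_on (sc I) r"
    and "linear_order_on (sk I) q"
    and "\<And>a'. a' \<in> sc (Up I) \<Longrightarrow> cm a' \<in> sc I \<and> cm a' \<le> a'"
    and "\<And>b'. b' \<in> sk (Down I) \<Longrightarrow> dm b' \<in> sk I \<and> dm b' \<ge> b'"
    and "b0 \<in> sk I" and "a0 \<in> sc I" and "b0 \<ge> a0"
  shows "int (multiplicity s M ((*) :: 'k \<Rightarrow> 'k \<Rightarrow> 'k) (interval_module I)) =
    int (mat_rank s (row_idx r I) (col_idx q I) (col_src M)
      (block_matrix
        (matM1 M r)        zero_block     zero_block
        (matM2 M cm)       zero_block     zero_block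
        (matM3 M b0 a0)    (matM4 M dm)   (matM5 M q))) -
    int (mat_rank s (row_idx r I) (col_idx q I) (col_src M)
      (block_matrix
        (matM1 M r)        zero_block     zero_block
        (matM2 M cm)       zero_block     zero_block
        zero_block         (matM4 M dm)   (matM5 M q)))"
proof -
  interpret interval_matrices s M I r q cm dm a0 b0
    using assms by (simp add: interval_matrices_def interval_matrices_axioms_def)
  let ?V = "interval_module I :: ('p, 'k) pmod"
  obtain n U where D: "indec_decomposition s M n U"
    using indec_decomposition_exists[OF assms(1)] by blast
  have "multiplicity s M (*) ?V = card {j. j < n \<and> pmod_iso s (restr M (U j)) (*) ?V}"
    unfolding multiplicity_def
  proof (rule the_equality)
    show "\<exists>n' U'. indec_decomposition s M n' U' \<and>
        card {j. j < n \<and> pmod_iso s (restr M (U j)) (*) ?V} =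
        card {j. j < n' \<and> pmod_iso s (restr M (U' j)) (*) ?V}"
      using D by blast
    fix m assume "\<exists>n' U'. indec_decomposition s M n' U' \<and>
        m = card {j. j < n' \<and> pmod_iso s (restr M (U' j)) (*) ?V}"
    then obtain n' U' where D': "indec_decomposition s M n' U'"
      and m: "m = card {j. j < n' \<and> pmod_iso s (restr M (U' j)) (*) ?V}" by blast
    show "m = card {j. j < n \<and> pmod_iso s (restr M (U j)) (*) ?V}"
      using dim_difference[OF D] dim_difference[OF D'] m by simp
  qed
  then show ?thesis
    using dim_difference[OF D] by (simp add: mat_rank_def mat_map_def sources_def)
qed

end
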